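(* Let $R_n=\mathbb{C}[x_1,\ldots,x_n]$, and for a partition $\lambda$ of $n$ let $I_\lambda\subseteq R_n$ be its Tanisaki ideal. Let $\dim_i(R_n/J)$ denote the dimension of the degree-$i$ part of $R_n/J$ for a homogeneous ideal $J$. Let $\{\lambda_n\}$ be a nested sequence of Young diagrams $\lambda_1\subseteq\lambda_2\subseteq\cdots$ such that $|\lambda_n|=n$ for all $n$. If for some $N$ the diagram $\lambda_N$ contains at least $k+1$ rows, then $$\dim_i\left(R_n/I_{\lambda_n}\right)=\dim_i\left(R_n/\langle e_1,\ldots,e_n\rangle\right)\quad\text{for all } i\le k \text{ and } n\ge N,$$ where $e_j=e_j(x_1,\ldots,x_n)$ is the $j$-th elementary symmetric polynomial. In particular, for all $i\le k$ and $n\ge N$ we have $\dim_i(R_n/I_{\lambda_n})=p_i(n)$, where $p_i(n)$ is the polynomial in $n$ that gives the number of permutations of the set $\{1,2,\ldots,n\}$ with exactly $i$ inversions.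
   Context: Partitions $\lambda=(\lambda_1\ge\lambda_2\ge\cdots)$ are identified with Young diagrams (left-justified rows, the longest row on top); $|\lambda|$ is the number of boxes and $\lambda\subseteq\lambda'$ means containment of diagrams. Tanisaki ideal. For $S\subseteq\{x_1,\ldots,x_n\}$ let $e_i(S)=\sum_{T\subseteq S,\,|T|=i}\prod_{x_j\in T}x_j$. Let $E_{i,j}^n$ be the set of all $e_i(S)$ with $S\subseteq\{x_1,\ldots,x_n\}$, $|S|=j$. For a partition $\lambda$ of $n$, the BFR-filling of $\lambda$ is obtained as follows: going through the columns from leftmost to rightmost, place the numbers $1,2,\ldots,n-\lambda_1$ bottom to top in each column, skipping the top row; then fill the top row from right to left with $n-\lambda_1+1,\ldots,n$. The set $\mathcal{G}(\lambda)$ is the union, over all boxes of $\lambda$, of the sets $E_{i,j}^n$ where $i$ is the entry of the box and $j$ is the entry of the top-row box in the same column. The Tanisaki ideal $I_\lambda\subseteq R_n$ is the ideal generated by $\mathcal{G}(\lambda)$ (by a theorem of Biagioli–Faridi–Rosas this agrees with Tanisaki's original definition). It is homogeneous. Rings are graded by polynomial degree. (The paper calls $R_n/\langle e_1,\ldots,e_n\rangle$ the diagonal coinvariant algebra.) For fixed $i$, the number of permutations of $\{1,\ldots,n\}$ with exactly $i$ inversions is given by a polynomial in $n$ for $n\ge i$; this polynomial is $p_i(n)$. *)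

theory Defs
  imports
    Complex_Main
    "HOL-Library.Poly_Mapping"
    "HOL-Computational_Algebra.Polynomial"
    "HOL-Combinatorics.Permutations"
    "HOL-Algebra.Embedded_Algebras"
    "HOL-Algebra.QuotRing"
begin

section \<open>The graded ring of polynomials in finitely many variables\<close>

text \<open>
  Polynomials are finitely supported maps from monomials to coefficients, and monomials are
  finitely supported exponent maps. The variables are indexed by all natural numbers; the
  ring in the variables with indices \<open>1, \<dots>, n\<close> is cut out by its carrier.
\<close>

type_synonym monomial = "nat \<Rightarrow>\<^sub>0 nat"
type_synonym cpoly = "monomial \<Rightarrow>\<^sub>0 complex"

definition var :: "nat \<Rightarrow> cpoly"
  where "var j = Poly_Mapping.single (Poly_Mapping.single j 1) 1"

definition const :: "complex \<Rightarrow> cpoly"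
  where "const c = Poly_Mapping.single 0 c"

definition mon_degree :: "monomial \<Rightarrow> nat"
  where "mon_degree m = (\<Sum>j \<in> Poly_Mapping.keys m. Poly_Mapping.lookup m j)"

definition poly_carrier :: "nat \<Rightarrow> cpoly set"
  where "poly_carrier n = {p. \<forall>m \<in> Poly_Mapping.keys p. Poly_Mapping.keys m \<subseteq> {1..n}}"

definition poly_ring :: "nat \<Rightarrow> cpoly ring"
  where "poly_ring n =
    \<lparr>carrier = poly_carrier n, monoid.mult = (*), one = 1, ring.zero = 0, add = (+)\<rparr>"

definition homogeneous_part :: "nat \<Rightarrow> nat \<Rightarrow> cpoly set"
  where "homogeneous_part n i =
    {p \<in> poly_carrier n. \<forall>m \<in> Poly_Mapping.keys p. mon_degree m = i}"

text \<open>
  The degree \<open>i\<close> part of the quotient by a homogeneous ideal \<open>J\<close> is the image of the degree \<open>i\<close>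
  part of the polynomial ring. The constants map onto a copy of the complex numbers in the
  quotient ring (if \<open>J\<close> is proper), over which the dimension is taken.
\<close>

definition quot_dim :: "nat \<Rightarrow> cpoly set \<Rightarrow> nat \<Rightarrow> nat"
  where "quot_dim n J i =
    ring.dim (poly_ring n Quot J)
      ((\<lambda>c. J +>\<^bsub>poly_ring n\<^esub> const c) ` UNIV)
      ((\<lambda>p. J +>\<^bsub>poly_ring n\<^esub> p) ` homogeneous_part n i)"


section \<open>Elementary symmetric polynomials\<close>

definition esym :: "nat \<Rightarrow> nat set \<Rightarrow> cpoly"
  where "esym i S = (\<Sum>T \<in> {T. T \<subseteq> S \<and> card T = i}. \<Prod>j\<in>T. var j)"

definition esyms :: "nat \<Rightarrow> nat \<Rightarrow> nat \<Rightarrow> cpoly set"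
  where "esyms n i j = {esym i S | S. S \<subseteq> {1..n} \<and> card S = j}"

definition coinvariant_ideal :: "nat \<Rightarrow> cpoly set"
  where "coinvariant_ideal n = genideal (poly_ring n) {esym j {1..n} | j. j \<in> {1..n}}"


section \<open>Partitions, Young diagrams and the Tanisaki ideal\<close>

definition partition_of :: "nat \<Rightarrow> nat list \<Rightarrow> bool"
  where "partition_of n l \<longleftrightarrow> sorted_wrt (\<ge>) l \<and> (\<forall>a \<in> set l. 0 < a) \<and> sum_list l = n"

text \<open>Boxes are pairs (row, column), both counted from 0; row 0 is the top (longest) row.\<close>

definition diagram :: "nat list \<Rightarrow> (nat \<times> nat) set"
  where "diagram l = {(r, c). r < length l \<and> c < l ! r}"

text \<open>
  \<open>fills_before b b'\<close> says that box \<open>b\<close> is filled no later than box \<open>b'\<close>: first come the boxes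
  below the top row, columns from left to right and each column from bottom to top, and then
  the top row from right to left. As the numbers \<open>1, 2, \<dots>\<close> are placed consecutively, the entry of
  a box is the number of boxes filled up to and including it.
\<close>

fun fills_before :: "nat \<times> nat \<Rightarrow> nat \<times> nat \<Rightarrow> bool"
  where "fills_before (r, c) (r', c') \<longleftrightarrow>
    (if r' = 0 then r \<noteq> 0 \<or> c' \<le> c
     else r \<noteq> 0 \<and> (c < c' \<or> c = c' \<and> r' \<le> r))"

definition bfr_entry :: "nat list \<Rightarrow> nat \<times> nat \<Rightarrow> nat"
  where "bfr_entry l b = card {b' \<in> diagram l. fills_before b' b}"

definition tanisaki_gens :: "nat list \<Rightarrow> cpoly set"
  where "tanisaki_gens l =
    (\<Union>(r, c) \<in> diagram l. esyms (sum_list l) (bfr_entry l (r, c)) (bfr_entry l (0, c)))"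

definition tanisaki_ideal :: "nat list \<Rightarrow> cpoly set"
  where "tanisaki_ideal l = genideal (poly_ring (sum_list l)) (tanisaki_gens l)"


section \<open>Permutations by number of inversions\<close>

definition inversions :: "nat \<Rightarrow> (nat \<Rightarrow> nat) \<Rightarrow> (nat \<times> nat) set"
  where "inversions n \<pi> = {(a, b). a \<in> {1..n} \<and> b \<in> {1..n} \<and> a < b \<and> \<pi> a > \<pi> b}"

definition inversion_number :: "nat \<Rightarrow> nat \<Rightarrow> nat"
  where "inversion_number n i = card {\<pi>. \<pi> permutes {1..n} \<and> card (inversions n \<pi>) = i}"

text \<open>
  The count of permutations with \<open>i\<close> inversions is polynomial in \<open>n\<close> only from \<open>n = i\<close> on; these
  infinitely many values determine the polynomial.
\<close>

definition inversion_poly :: "nat \<Rightarrow> rat poly"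
  where "inversion_poly i =
    (THE p. \<forall>n\<ge>i. poly p (of_nat n) = of_nat (inversion_number n i))"


section \<open>Basic facts\<close>

lemma poly_carrier_add: "p \<in> poly_carrier n \<Longrightarrow> q \<in> poly_carrier n \<Longrightarrow> p + q \<in> poly_carrier n"
  unfolding poly_carrier_def using Poly_Mapping.keys_add[of p q] by blast

lemma poly_carrier_uminus: "p \<in> poly_carrier n \<Longrightarrow> - p \<in> poly_carrier n"
  by (auto simp: poly_carrier_def in_keys_iff)

lemma poly_carrier_mult: "p \<in> poly_carrier n \<Longrightarrow> q \<in> poly_carrier n \<Longrightarrow> p * q \<in> poly_carrier n"
  unfolding poly_carrier_def
proof (safe)
  fix m x
  assume p: "\<forall>m\<in>Poly_Mapping.keys p. Poly_Mapping.keys m \<subseteq> {1..n}"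
    and q: "\<forall>m\<in>Poly_Mapping.keys q. Poly_Mapping.keys m \<subseteq> {1..n}"
    and m: "m \<in> Poly_Mapping.keys (p * q)" and x: "x \<in> Poly_Mapping.keys m"
  obtain a b where ab: "m = a + b" "a \<in> Poly_Mapping.keys p" "b \<in> Poly_Mapping.keys q"
    using keys_mult[of p q] m by blast
  then show "x \<in> {1..n}"
    using p q x Poly_Mapping.keys_add[of a b] by blast
qed

lemma const_in_poly_carrier: "const c \<in> poly_carrier n"
  by (simp add: const_def poly_carrier_def)

lemma cring_poly_ring: "cring (poly_ring n)"
proof (rule cringI)
  show "abelian_group (poly_ring n)"
  proof (rule abelian_groupI)
    fix p assume "p \<in> carrier (poly_ring n)"
    then show "\<exists>q\<in>carrier (poly_ring n). q \<oplus>\<^bsub>poly_ring n\<^esub> p = \<zero>\<^bsub>poly_ring n\<^esub>"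
      by (intro bexI[of _ "- p"]) (auto simp: poly_ring_def poly_carrier_uminus)
  qed (auto simp: poly_ring_def poly_carrier_add algebra_simps, auto simp: poly_carrier_def)
  show "comm_monoid (poly_ring n)"
    by (rule comm_monoidI)
      (auto simp: poly_ring_def poly_carrier_mult algebra_simps, auto simp: poly_carrier_def)
qed (auto simp: poly_ring_def algebra_simps)

end

theory Submission
  imports Defs
begin

text \<open>
  In degree \<open>i\<close>, the quotient by a homogeneous ideal depends only on the generators of degree at
  most \<open>i\<close> (\<open>homogeneous_in_genideal_iff\<close>, \<open>graded_span_cong\<close>). So the theorem rests on a look at the
  entries of the BFR-filling of a partition with \<open>l\<close> rows. The boxes of the first column below the
  top row carry \<open>1, \<dots>, l - 1\<close> and the top box of that column carries \<open>n\<close>, so the former contribute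
  \<open>e\<^sub>1, \<dots>, e\<^sub>l\<^sub>-\<^sub>1\<close> of all the variables. Every other box, the top left one included, is filled after
  these \<open>l - 1\<close> boxes; its entry, which is the degree of the generators it contributes, is
  therefore at least \<open>l\<close>. Hence the Tanisaki ideal and the ideal of the elementary symmetric polynomials have the same
  generators in all degrees below \<open>l\<close> (\<open>graded_tanisaki_gens_low_degree\<close>). By nestedness every
  \<open>lam n\<close> with \<open>n \<ge> N\<close> has at least \<open>k + 1\<close> rows, so the degrees up to \<open>k\<close> are covered.
  
  For the value of the dimension, both quotients get the same basis in these degrees: the Artin
  monomials, in which the exponent of \<open>x\<^sub>j\<close> is at most \<open>n - j\<close>.
  
  They span because modulo the symmetric ideal the elementary symmetric polynomials of
  \<open>x\<^sub>j\<^sub>+\<^sub>1, \<dots>, x\<^sub>n\<close> agree up to sign with the complete homogeneous ones of \<open>x\<^sub>1, \<dots>, x\<^sub>j\<close>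
  (\<open>signed_esym_congruent_complete_sym\<close>). Of the former, the one of degree \<open>n - j + 1\<close> vanishes, so
  \<open>x\<^sub>j\<close> to the power \<open>n - j + 1\<close> can be exchanged for monomials that involve more of the
  variables with smaller index; this terminates (\<open>artin_monomials_span\<close>).
  
  They are independent because they are so as functions on the \<open>n!\<close> permutations of
  \<open>(1, \<dots>, n)\<close> (\<open>artin_polynomial_vanishing\<close>). On these points the elementary symmetric polynomials are
  constant, so an element of degree \<open>d\<close> of the symmetric ideal agrees there with a polynomial of
  degree less than \<open>d\<close>, and by the spanning property with a combination of Artin monomials of degree
  less than \<open>d\<close>. A combination of Artin monomials of degree exactly \<open>d\<close> can do that only if it is zero
  (\<open>artin_monomials_independent\<close>).
  
  Finally, the exponent vectors of the Artin monomials are the Lehmer codes of the permutations, and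
  the degree is the number of inversions (\<open>card_artin_monomials\<close>). Counting codes by their first
  entry shows that the number \<open>c n i\<close> of codes with sum \<open>i\<close> satisfies
  \<open>c (n + 1) (i + 1) - c n (i + 1) = c (n + 1) i\<close> for \<open>n > i\<close>, so that it is polynomial in \<open>n\<close> from
  \<open>n = i\<close> on, by summation (\<open>code_count_polynomial\<close>).
\<close>

section \<open>Polynomials with restricted support\<close>

lemma poly_mapping_expansion:
  "(p :: cpoly) = (\<Sum>m\<in>Poly_Mapping.keys p. Poly_Mapping.single m (Poly_Mapping.lookup p m))"
  by (rule poly_mapping_eqI) (auto simp: lookup_sum lookup_single when_def in_keys_iff sum.delta' if_distrib cong: if_cong)

lemma lookup_const_mult: "Poly_Mapping.lookup (const c * p) m = c * Poly_Mapping.lookup p m"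
  unfolding const_def mult_map_scale_conv_mult[symmetric]
  by (simp add: Poly_Mapping.map.rep_eq when_def)

lemma const_mult_single: "const c * Poly_Mapping.single m a = Poly_Mapping.single m (c * a)"
  by (simp add: const_def mult_single)

lemma const_0 [simp]: "const 0 = 0" and const_1 [simp]: "const 1 = 1"
  by (simp_all add: const_def)

lemma const_add: "const (a + b) = const a + const b"
  by (simp add: const_def single_add)

lemma const_mult: "const (a * b) = const a * const b"
  by (simp add: const_def mult_single)

text \<open>
  Homogeneity, the number of variables, degree bounds and the Artin condition all restrict the
  monomials that may occur, and are treated uniformly through this set.
\<close>

definition supported :: "(monomial \<Rightarrow> bool) \<Rightarrow> cpoly set"
  where "supported P = {p. \<forall>m\<in>Poly_Mapping.keys p. P m}"

lemma supported_0 [simp]: "0 \<in> supported P"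
  by (simp add: supported_def)

lemma supported_add: "p \<in> supported P \<Longrightarrow> q \<in> supported P \<Longrightarrow> p + q \<in> supported P"
  using Poly_Mapping.keys_add[of p q] by (auto simp: supported_def)

lemma supported_uminus: "p \<in> supported P \<Longrightarrow> - p \<in> supported P"
  by (auto simp: supported_def in_keys_iff)

lemma supported_diff: "p \<in> supported P \<Longrightarrow> q \<in> supported P \<Longrightarrow> p - q \<in> supported P"
  using supported_add[of p P "- q"] supported_uminus[of q P] by simp

lemma supported_scale: "p \<in> supported P \<Longrightarrow> const c * p \<in> supported P"
  by (auto simp: supported_def in_keys_iff lookup_const_mult)

lemma supported_single: "P m \<Longrightarrow> Poly_Mapping.single m c \<in> supported P"
  by (simp add: supported_def)

lemma supported_sum: "(\<And>x. x \<in> A \<Longrightarrow> f x \<in> supported P) \<Longrightarrow> sum f A \<in> supported P"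
  by (induction A rule: infinite_finite_induct) (auto intro: supported_add)

lemma supported_mult:
  assumes "p \<in> supported P" "q \<in> supported Q" "\<And>a b. P a \<Longrightarrow> Q b \<Longrightarrow> R (a + b)"
  shows "p * q \<in> supported R"
  using assms keys_mult[of p q] unfolding supported_def by fastforce

lemma supported_mono: "p \<in> supported P \<Longrightarrow> (\<And>m. P m \<Longrightarrow> Q m) \<Longrightarrow> p \<in> supported Q"
  by (auto simp: supported_def)

lemma supported_induct:
  assumes "p \<in> supported P"
    and "0 \<in> V" and "\<And>p q. p \<in> V \<Longrightarrow> q \<in> V \<Longrightarrow> p + q \<in> V"
    and "\<And>c p. p \<in> V \<Longrightarrow> const c * p \<in> V"
    and "\<And>m. P m \<Longrightarrow> Poly_Mapping.single m 1 \<in> V"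
  shows "p \<in> V"
proof -
  have "(\<Sum>m\<in>A. Poly_Mapping.single m (Poly_Mapping.lookup p m)) \<in> V"
    if "finite A" "A \<subseteq> Poly_Mapping.keys p" for A
    using that
  proof (induction A rule: finite_induct)
    case (insert m A)
    have "const (Poly_Mapping.lookup p m) * Poly_Mapping.single m 1 \<in> V"
      using assms(1,4,5) insert.prems by (auto simp: supported_def)
    then show ?case
      using insert assms(3) by (simp add: const_mult_single)
  qed (simp add: assms(2))
  then show ?thesis
    using poly_mapping_expansion[of p] by (metis finite_keys order_refl)
qed

text \<open>
  The degree is the case of all weights being 1. Weight \<open>j\<close> for the variable of index \<open>j\<close> is what
  decreases when powers are moved to variables of smaller index.
\<close>

definition mon_weight :: "(nat \<Rightarrow> nat) \<Rightarrow> monomial \<Rightarrow> nat"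
  where "mon_weight w m = (\<Sum>j\<in>Poly_Mapping.keys m. w j * Poly_Mapping.lookup m j)"

lemma mon_weight_superset:
  "finite A \<Longrightarrow> Poly_Mapping.keys m \<subseteq> A \<Longrightarrow> mon_weight w m = (\<Sum>j\<in>A. w j * Poly_Mapping.lookup m j)"
  unfolding mon_weight_def by (rule sum.mono_neutral_left) (auto simp: in_keys_iff)

lemma mon_weight_add: "mon_weight w (a + b) = mon_weight w a + mon_weight w b"
proof -
  let ?A = "Poly_Mapping.keys a \<union> Poly_Mapping.keys b"
  show ?thesis
    using mon_weight_superset[of ?A a w] mon_weight_superset[of ?A b w]
      mon_weight_superset[of ?A "a + b" w] Poly_Mapping.keys_add[of a b]
    by (simp add: lookup_add sum.distrib distrib_left)
qed

lemma mon_weight_single [simp]: "mon_weight w (Poly_Mapping.single j a) = w j * a"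
  by (simp add: mon_weight_def)

lemma mon_degree_eq_weight: "mon_degree = mon_weight (\<lambda>_. 1)"
  by (simp add: fun_eq_iff mon_degree_def mon_weight_def)

lemma mon_degree_add: "mon_degree (a + b) = mon_degree a + mon_degree b"
  by (simp add: mon_degree_eq_weight mon_weight_add)

lemma mon_degree_single [simp]: "mon_degree (Poly_Mapping.single j a) = a"
  by (simp add: mon_degree_eq_weight)

lemma mon_degree_0 [simp]: "mon_degree 0 = 0"
  by (simp add: mon_degree_def)

lemma homogeneous_part_eq:
  "homogeneous_part n i = supported (\<lambda>m. Poly_Mapping.keys m \<subseteq> {1..n} \<and> mon_degree m = i)"
  by (auto simp: homogeneous_part_def poly_carrier_def supported_def)

lemma poly_carrier_eq: "poly_carrier n = supported (\<lambda>m. Poly_Mapping.keys m \<subseteq> {1..n})"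
  by (auto simp: poly_carrier_def supported_def)

lemma homogeneous_part_subset_carrier: "p \<in> homogeneous_part n i \<Longrightarrow> p \<in> poly_carrier n"
  by (simp add: homogeneous_part_def)

lemma homogeneous_part_mult:
  assumes "p \<in> homogeneous_part n a" "q \<in> homogeneous_part n b"
  shows "p * q \<in> homogeneous_part n (a + b)"
  unfolding homogeneous_part_eq
  by (rule supported_mult[OF assms[unfolded homogeneous_part_eq]])
    (auto simp: mon_degree_add dest: subsetD[OF Poly_Mapping.keys_add])

lemma const_homogeneous: "const c \<in> homogeneous_part n 0"
  unfolding homogeneous_part_eq const_def by (rule supported_single) simp

lemma var_homogeneous: "j \<in> {1..n} \<Longrightarrow> var j \<in> homogeneous_part n 1"
  unfolding homogeneous_part_eq var_def by (rule supported_single) simp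

definition hom_component :: "nat \<Rightarrow> cpoly \<Rightarrow> cpoly"
  where "hom_component d p =
    (\<Sum>m\<in>{m\<in>Poly_Mapping.keys p. mon_degree m = d}. Poly_Mapping.single m (Poly_Mapping.lookup p m))"

lemma lookup_hom_component:
  "Poly_Mapping.lookup (hom_component d p) m = (if mon_degree m = d then Poly_Mapping.lookup p m else 0)"
proof -
  have "Poly_Mapping.lookup (hom_component d p) m =
      (\<Sum>k\<in>{k\<in>Poly_Mapping.keys p. mon_degree k = d}. if m = k then Poly_Mapping.lookup p k else 0)"
    by (auto simp: hom_component_def lookup_sum lookup_single when_def intro!: sum.cong)
  also have "\<dots> = (if mon_degree m = d then Poly_Mapping.lookup p m else 0)"
    by (subst sum.delta') (auto simp: in_keys_iff)
  finally show ?thesis .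
qed

lemma hom_component_add: "hom_component d (p + q) = hom_component d p + hom_component d q"
  by (rule poly_mapping_eqI) (simp add: lookup_hom_component lookup_add)

lemma hom_component_0 [simp]: "hom_component d 0 = 0"
  by (rule poly_mapping_eqI) (simp add: lookup_hom_component)

lemma hom_component_sum: "hom_component d (sum f A) = (\<Sum>x\<in>A. hom_component d (f x))"
  by (induction A rule: infinite_finite_induct) (simp_all add: hom_component_add)

lemma hom_component_homogeneous:
  "p \<in> homogeneous_part n e \<Longrightarrow> hom_component d p = (if d = e then p else 0)"
  by (rule poly_mapping_eqI)
    (auto simp: lookup_hom_component homogeneous_part_def in_keys_iff)

lemma hom_component_in:
  "p \<in> poly_carrier n \<Longrightarrow> hom_component d p \<in> homogeneous_part n d"
  by (auto simp: homogeneous_part_def poly_carrier_def in_keys_iff lookup_hom_component split: if_splits)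

lemma sum_hom_components:
  obtains D where "finite D" "p = (\<Sum>d\<in>D. hom_component d p)"
proof
  let ?D = "mon_degree ` Poly_Mapping.keys p"
  show "p = (\<Sum>d\<in>?D. hom_component d p)"
    by (rule poly_mapping_eqI)
      (auto simp: lookup_sum lookup_hom_component sum.delta' in_keys_iff image_iff)
qed simp

lemma poly_ring_simps:
  "carrier (poly_ring n) = poly_carrier n" "x \<otimes>\<^bsub>poly_ring n\<^esub> y = x * y"
  "x \<oplus>\<^bsub>poly_ring n\<^esub> y = x + y" "\<one>\<^bsub>poly_ring n\<^esub> = 1" "\<zero>\<^bsub>poly_ring n\<^esub> = 0"
  by (simp_all add: poly_ring_def)

lemma poly_ring_uminus:
  assumes "p \<in> poly_carrier n"
  shows "\<ominus>\<^bsub>poly_ring n\<^esub> p = - p"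
proof -
  interpret cring "poly_ring n" by (rule cring_poly_ring)
  show ?thesis
    using assms by (intro sum_zero_eq_neg[symmetric]) (auto simp: poly_ring_simps poly_carrier_uminus)
qed

section \<open>Graded ideals\<close>

text \<open>
  The degree \<open>d\<close> part of the ideal generated by the sets \<open>G b\<close> of homogeneous polynomials of degree
  \<open>b\<close>. Only homogeneous multipliers are used, so that the degrees of the generators that can take part
  are visible.
\<close>

inductive_set graded_span :: "nat \<Rightarrow> (nat \<Rightarrow> cpoly set) \<Rightarrow> nat \<Rightarrow> cpoly set"
  for n G d where
    zero: "0 \<in> graded_span n G d"
  | step: "p \<in> graded_span n G d \<Longrightarrow> g \<in> homogeneous_part n a \<Longrightarrow> f \<in> G b \<Longrightarrow> a + b = d
      \<Longrightarrow> p + g * f \<in> graded_span n G d"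

lemma graded_span_add:
  assumes "p \<in> graded_span n G d" "q \<in> graded_span n G d"
  shows "p + q \<in> graded_span n G d"
  using assms(2)
proof induction
  case (step q g a f b)
  then have "(p + q) + g * f \<in> graded_span n G d"
    by (intro graded_span.step)
  then show ?case by (simp add: add.assoc)
qed (simp add: assms(1))

lemma graded_span_mult:
  assumes "p \<in> graded_span n G d" "u \<in> homogeneous_part n e"
  shows "u * p \<in> graded_span n G (e + d)"
  using assms(1)
proof induction
  case (step p g a f b)
  have "u * p + (u * g) * f \<in> graded_span n G (e + d)"
    using graded_span.step[OF step(5) homogeneous_part_mult[OF assms(2) step(2)] step(3)] step(4)
    by simp
  then show ?case by (simp add: algebra_simps)
qed (simp add: graded_span.zero)

lemma graded_span_scale: "p \<in> graded_span n G d \<Longrightarrow> const c * p \<in> graded_span n G d"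
  using graded_span_mult[OF _ const_homogeneous, of p n G d c] by simp

lemma graded_span_uminus: "p \<in> graded_span n G d \<Longrightarrow> - p \<in> graded_span n G d"
  using graded_span_scale[of p n G d "-1"] by (simp add: const_def single_uminus)

lemma graded_span_sum:
  "(\<And>x. x \<in> A \<Longrightarrow> f x \<in> graded_span n G d) \<Longrightarrow> sum f A \<in> graded_span n G d"
  by (induction A rule: infinite_finite_induct) (auto intro: graded_span_add graded_span.zero)

lemma graded_span_generator:
  assumes "f \<in> G d"
  shows "f \<in> graded_span n G d"
  using graded_span.step[where p = 0 and g = "const 1" and a = 0 and b = d and f = f] assms
  by (simp add: graded_span.zero const_homogeneous del: const_1) simp

text \<open>
  The degree of the generators involved never exceeds the degree of the result.
\<close>

lemma graded_span_cong:
  assumes "\<And>e. e \<le> d \<Longrightarrow> G e = H e"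
  shows "graded_span n G d = graded_span n H d"
proof -
  have "graded_span n G d \<subseteq> graded_span n H d" if "\<And>e. e \<le> d \<Longrightarrow> G e = H e" for G H
  proof
    fix p assume "p \<in> graded_span n G d"
    then show "p \<in> graded_span n H d"
      by induction (use that in \<open>auto intro!: graded_span.intros\<close>)
  qed
  from this[of G H] this[of H G] show ?thesis using assms by blast
qed

lemma graded_span_homogeneous:
  assumes "\<And>e. G e \<subseteq> homogeneous_part n e" "p \<in> graded_span n G d"
  shows "p \<in> homogeneous_part n d"
  using assms(2)
proof induction
  case (step p g a f b)
  then have "g * f \<in> homogeneous_part n d"
    using homogeneous_part_mult[of g n a f b] assms(1) by auto
  then show ?case using step by (auto simp: homogeneous_part_eq intro: supported_add)
qed (simp add: homogeneous_part_eq)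

text \<open>
  Closure under multiplication: splitting both factors into components, the degree \<open>c\<close> component of a
  product is the sum of the products of components whose degrees add up to \<open>c\<close>.
\<close>

lemma ideal_of_graded_span:
  "ideal {p \<in> poly_carrier n. \<forall>d. hom_component d p \<in> graded_span n G d} (poly_ring n)"
    (is "ideal ?I _")
proof (rule idealI)
  interpret cring "poly_ring n" by (rule cring_poly_ring)
  show "ring (poly_ring n)" by (rule ring_axioms)
  have comp_uminus: "hom_component d (- p) = - hom_component d p" for d p
    by (rule poly_mapping_eqI) (simp add: lookup_hom_component)
  show "subgroup ?I (add_monoid (poly_ring n))"
  proof (rule add.subgroupI)
    show "?I \<noteq> {}" using graded_span.zero[of n G] by (auto simp: poly_carrier_eq intro!: exI[of _ 0])
  qed (auto simp: a_inv_def[symmetric] poly_ring_simps poly_ring_uminus poly_carrier_uminus comp_uminus graded_span_uminus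
      hom_component_add poly_carrier_add graded_span_add)
  have mult: "r * p \<in> ?I" if p: "p \<in> ?I" and r: "r \<in> poly_carrier n" for p r
  proof -
    obtain D where D: "finite D" "p = (\<Sum>d\<in>D. hom_component d p)" by (rule sum_hom_components)
    obtain E where E: "finite E" "r = (\<Sum>e\<in>E. hom_component e r)" by (rule sum_hom_components)
    have in_span: "hom_component e r * hom_component d p \<in> graded_span n G (e + d)" for e d
      using p r by (intro graded_span_mult hom_component_in) auto
    have homog: "hom_component e r * hom_component d p \<in> homogeneous_part n (e + d)" for e d
      using p r by (intro homogeneous_part_mult hom_component_in) auto
    have "hom_component c (r * p) \<in> graded_span n G c" for c
    proof -
      have "r * p = (\<Sum>e\<in>E. \<Sum>d\<in>D. hom_component e r * hom_component d p)"
        by (subst E(2), subst D(2)) (simp add: sum_product)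
      then have "hom_component c (r * p) =
          (\<Sum>e\<in>E. \<Sum>d\<in>D. if c = e + d then hom_component e r * hom_component d p else 0)"
        by (simp add: hom_component_sum hom_component_homogeneous[OF homog])
      also have "\<dots> \<in> graded_span n G c"
        by (intro graded_span_sum) (auto intro: in_span graded_span.zero)
      finally show ?thesis .
    qed
    then show ?thesis using p r by (auto intro: poly_carrier_mult)
  qed
  show "x \<otimes>\<^bsub>poly_ring n\<^esub> a \<in> ?I" if "a \<in> ?I" "x \<in> carrier (poly_ring n)" for a x
    using mult that by (simp add: poly_ring_def)
  show "a \<otimes>\<^bsub>poly_ring n\<^esub> x \<in> ?I" if "a \<in> ?I" "x \<in> carrier (poly_ring n)" for a x
    using mult[of a x] that by (simp add: poly_ring_def mult.commute)
qed

text \<open>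
  From left to right, the ideal of \<open>ideal_of_graded_span\<close> contains the generators, hence the generated
  ideal, and \<open>p\<close> is its own component of degree \<open>d\<close>.
\<close>

lemma homogeneous_in_genideal_iff:
  assumes G: "\<And>e. G e \<subseteq> homogeneous_part n e" and p: "p \<in> homogeneous_part n d"
  shows "p \<in> genideal (poly_ring n) (\<Union>e. G e) \<longleftrightarrow> p \<in> graded_span n G d"
proof
  interpret cring "poly_ring n" by (rule cring_poly_ring)
  have sub: "(\<Union>e. G e) \<subseteq> carrier (poly_ring n)"
    using G by (fastforce simp: poly_ring_def dest: homogeneous_part_subset_carrier)
  interpret I: ideal "genideal (poly_ring n) (\<Union>e. G e)" "poly_ring n"
    using sub by (rule genideal_ideal)
  {
    let ?I = "{p \<in> poly_carrier n. \<forall>d. hom_component d p \<in> graded_span n G d}"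
    assume "p \<in> genideal (poly_ring n) (\<Union>e. G e)"
    moreover have "genideal (poly_ring n) (\<Union>e. G e) \<subseteq> ?I"
    proof (rule genideal_minimal[OF ideal_of_graded_span], safe)
      fix f e d assume f: "f \<in> G e"
      then have h: "f \<in> homogeneous_part n e" using G by blast
      then show "f \<in> poly_carrier n" by (rule homogeneous_part_subset_carrier)
      show "hom_component d f \<in> graded_span n G d"
        using f by (auto simp: hom_component_homogeneous[OF h] intro: graded_span_generator graded_span.zero)
    qed
    ultimately have "hom_component d p \<in> graded_span n G d" by blast
    then show "p \<in> graded_span n G d" by (simp add: hom_component_homogeneous[OF p])
  next
    assume "p \<in> graded_span n G d"
    then show "p \<in> genideal (poly_ring n) (\<Union>e. G e)"
    proof induction
      case zero
      show ?case using I.zero_closed by (simp add: poly_ring_def)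
    next
      case (step p g a f b)
      have "g * f \<in> genideal (poly_ring n) (\<Union>e. G e)"
        using I.I_l_closed[of f g] step(2,3) genideal_self[OF sub]
        by (auto simp: poly_ring_def dest: homogeneous_part_subset_carrier)
      then show ?case using I.a_closed[OF step(5)] by (simp add: poly_ring_def)
    qed
  }
qed

section \<open>Dimensions of graded pieces from monomial bases\<close>

text \<open>
  The complex numbers as a ring structure, so that the constants in the polynomial ring, and then
  those in its quotients, are recognized as homomorphic images of a field.
\<close>

definition complex_ring :: "complex ring"
  where "complex_ring = \<lparr>carrier = UNIV, monoid.mult = (*), one = 1, ring.zero = 0, add = (+)\<rparr>"

lemma field_complex_ring: "field complex_ring"
proof (rule cring.cring_fieldI2)
  show "cring complex_ring"
  proof (rule cringI)
    show "abelian_group complex_ring"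
    proof (rule abelian_groupI)
      fix x assume "x \<in> carrier complex_ring"
      show "\<exists>y\<in>carrier complex_ring. y \<oplus>\<^bsub>complex_ring\<^esub> x = \<zero>\<^bsub>complex_ring\<^esub>"
        by (intro bexI[of _ "- x"]) (auto simp: complex_ring_def)
    qed (auto simp: complex_ring_def)
    show "comm_monoid complex_ring"
      by (rule comm_monoidI) (auto simp: complex_ring_def)
  qed (auto simp: complex_ring_def algebra_simps)
  show "\<zero>\<^bsub>complex_ring\<^esub> \<noteq> \<one>\<^bsub>complex_ring\<^esub>" by (simp add: complex_ring_def)
  fix a assume "a \<in> carrier complex_ring" "a \<noteq> \<zero>\<^bsub>complex_ring\<^esub>"
  then show "\<exists>b\<in>carrier complex_ring. a \<otimes>\<^bsub>complex_ring\<^esub> b = \<one>\<^bsub>complex_ring\<^esub>"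
    by (intro bexI[of _ "inverse a"]) (auto simp: complex_ring_def)
qed

lemma subfield_constants: "subfield (range const) (poly_ring n)"
proof -
  interpret F: field complex_ring by (rule field_complex_ring)
  interpret R: cring "poly_ring n" by (rule cring_poly_ring)
  interpret h: ring_hom_ring complex_ring "poly_ring n" const
    by unfold_locales
      (auto simp: ring_hom_def complex_ring_def poly_ring_def const_in_poly_carrier const_add const_mult)
  have "subfield (const ` carrier complex_ring) (poly_ring n)"
    by (intro h.img_is_subfield F.subfield_iff(1)) (use field_complex_ring in \<open>auto simp: poly_ring_def\<close>)
  then show ?thesis by (simp add: complex_ring_def)
qed

lemma combine_poly_ring:
  assumes "length cs = length ps"
  shows "ring.combine (poly_ring n) (map const cs) ps = (\<Sum>(c, p)\<leftarrow>zip cs ps. const c * p)"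
proof -
  interpret R: cring "poly_ring n" by (rule cring_poly_ring)
  show ?thesis using assms
    by (induction cs ps rule: list_induct2) (simp_all only: R.combine.simps list.map zip.simps list.case
        sum_list.Nil sum_list.Cons split_conv poly_ring_simps)
qed

lemma combine_monomials:
  assumes "length cs = length ms" "distinct ms"
  shows "Poly_Mapping.lookup (\<Sum>(c, p)\<leftarrow>zip cs (map (\<lambda>m. Poly_Mapping.single m 1) ms). const c * p) m
    = (if m \<in> set ms then the (map_of (zip ms cs) m) else 0)"
  using assms
  by (induction cs ms rule: list_induct2)
     (auto simp: lookup_add const_mult_single lookup_single when_def)

text \<open>
  The bridge from dimensions in the quotient ring to polynomials modulo the ideal: a finite set of
  monomials that spans the degree \<open>i\<close> part modulo \<open>J\<close> and is independent modulo \<open>J\<close> determines its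
  dimension. The ideal has to be proper because otherwise the constants collapse to the zero ring and
  are not a field.
\<close>

lemma quot_dim_eq_card_monomials:
  assumes J: "ideal J (poly_ring n)" and proper: "1 \<notin> J"
    and B: "finite B" "\<And>m. m \<in> B \<Longrightarrow> Poly_Mapping.single m 1 \<in> homogeneous_part n i"
    and spanning: "\<And>p. p \<in> homogeneous_part n i \<Longrightarrow> \<exists>q\<in>supported (\<lambda>m. m \<in> B). p - q \<in> J"
    and indep: "\<And>q. q \<in> supported (\<lambda>m. m \<in> B) \<Longrightarrow> q \<in> J \<Longrightarrow> q = 0"
  shows "quot_dim n J i = card B"
proof -
  interpret R: cring "poly_ring n" by (rule cring_poly_ring)
  interpret J: ideal J "poly_ring n" by (rule J)
  let ?Q = "poly_ring n Quot J" and ?h = "\<lambda>p. J +>\<^bsub>poly_ring n\<^esub> p"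
  interpret h: ring_hom_ring "poly_ring n" ?Q ?h by (rule J.rcos_ring_hom_ring)
  have coset_eq: "?h p = ?h q \<longleftrightarrow> p - q \<in> J" if "p \<in> poly_carrier n" "q \<in> poly_carrier n" for p q
    using R.quotient_eq_iff_same_a_r_cos[OF J, of p q] that
    by (simp add: a_minus_def poly_ring_uminus poly_ring_simps)
  have zero_iff: "?h p = \<zero>\<^bsub>?Q\<^esub> \<longleftrightarrow> p \<in> J" if "p \<in> poly_carrier n" for p
    using R.a_rcos_zero[OF J] J.rcos_const_imp_mem that by (auto simp: FactRing_def poly_ring_simps)
  define K where "K = ?h ` range const"
  have one_not_zero: "\<one>\<^bsub>?Q\<^esub> \<noteq> \<zero>\<^bsub>?Q\<^esub>"
    using zero_iff[of 1] proper h.hom_one const_in_poly_carrier[of 1 n] by (simp add: poly_ring_def)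
  have K: "subfield K ?Q"
    unfolding K_def by (rule h.img_is_subfield(2)[OF subfield_constants one_not_zero])
  obtain ms where ms: "set ms = B" "distinct ms" "length ms = card B"
    using finite_distinct_list[OF B(1)] distinct_card by metis
  define ps where "ps = map (\<lambda>m. Poly_Mapping.single m (1::complex)) ms"
  \<comment> \<open>All scalar lists below are lists of cosets of constants, so every combination in the
    quotient is the coset of such a polynomial.\<close>
  define comb where "comb cs = (\<Sum>(c, p)\<leftarrow>zip cs ps. const c * p)" for cs
  have ps_hom: "p \<in> homogeneous_part n i" if "p \<in> set ps" for p
    using that B(2) ms by (auto simp: ps_def)
  then have ps_carr: "set ps \<subseteq> carrier (poly_ring n)"
    by (auto simp: poly_ring_def dest: homogeneous_part_subset_carrier)
  have len_ps: "length ps = length ms" by (simp add: ps_def)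
  have comb: "h.S.combine (map ?h (map const cs)) (map ?h ps) = ?h (comb cs)"
    if "length cs = length ms" for cs
    unfolding comb_def
    by (subst h.combine_hom)
       (use that ps_carr in \<open>auto simp: len_ps combine_poly_ring poly_ring_simps const_in_poly_carrier\<close>)
  have lookup_comb: "Poly_Mapping.lookup (comb cs) m = (if m \<in> B then the (map_of (zip ms cs) m) else 0)"
    if "length cs = length ms" for cs m
    using combine_monomials[OF that ms(2)] by (simp add: comb_def ps_def ms(1))
  have comb_supp: "comb cs \<in> supported (\<lambda>m. m \<in> B)" if "length cs = length ms" for cs
    using that by (auto simp: supported_def in_keys_iff lookup_comb split: if_splits)
  have supp_hom: "q \<in> homogeneous_part n i" if "q \<in> supported (\<lambda>m. m \<in> B)" for q
    using that B(2) by (fastforce simp: supported_def homogeneous_part_def poly_carrier_def)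
  have supp_comb: "\<exists>cs. length cs = length ms \<and> q = comb cs" if "q \<in> supported (\<lambda>m. m \<in> B)" for q
  proof (intro exI conjI)
    let ?cs = "map (Poly_Mapping.lookup q) ms"
    show len: "length ?cs = length ms" by simp
    show "q = comb ?cs"
      using that
      by (intro poly_mapping_eqI)
        (auto simp: lookup_comb supported_def in_keys_iff map_of_zip_map ms(1))
  qed
  have carr_Q: "set (map ?h ps) \<subseteq> carrier ?Q"
    using ps_carr by auto
  have K_lists: "\<exists>cs. length cs = length Ks \<and> Ks = map ?h (map const cs)" if "set Ks \<subseteq> K" for Ks
    using that
  proof (induction Ks)
    case (Cons k Ks)
    then obtain cs c where "length cs = length Ks" "Ks = map ?h (map const cs)" "k = ?h (const c)"
      by (auto simp: K_def)
    then show ?case by (intro exI[of _ "c # cs"]) auto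
  qed simp
  have "h.S.independent K (map ?h ps)"
  proof (rule h.S.trivial_combine_imp_independent[OF K carr_Q])
    fix Ks assume Ks: "set Ks \<subseteq> K" "h.S.combine Ks (map ?h ps) = \<zero>\<^bsub>?Q\<^esub>"
    \<comment> \<open>The list of scalars may have any length; cut it or pad it with zeros.\<close>
    obtain Ks' where Ks': "set (take (length (map ?h ps)) Ks) \<subseteq> set Ks'"
        "set Ks' \<subseteq> set (take (length (map ?h ps)) Ks) \<union> {\<zero>\<^bsub>?Q\<^esub>}"
        "length Ks' = length (map ?h ps)" "h.S.combine Ks' (map ?h ps) = \<zero>\<^bsub>?Q\<^esub>"
      using h.S.combine_normalize[OF _ carr_Q Ks(2)] Ks(1) subfieldE(3)[OF K] by blast
    have "set Ks' \<subseteq> K"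
      using Ks'(2) Ks(1) subringE(2)[OF subfieldE(1)[OF K]] by (auto dest: in_set_takeD)
    then obtain cs where cs: "length cs = length ms" "Ks' = map ?h (map const cs)"
      using K_lists Ks'(3) by (metis len_ps length_map)
    have "?h (comb cs) = \<zero>\<^bsub>?Q\<^esub>"
      using Ks'(4) unfolding cs(2) comb[OF cs(1)] .
    then have "comb cs \<in> J"
      using zero_iff[OF homogeneous_part_subset_carrier[OF supp_hom[OF comb_supp[OF cs(1)]]]] by blast
    then have zero: "comb cs = 0" using indep comb_supp[OF cs(1)] by blast
    have "c = 0" if c: "c \<in> set cs" for c
    proof -
      obtain k where k: "k < length cs" "c = cs ! k" using c by (auto simp: in_set_conv_nth)
      then have "the (map_of (zip ms cs) (ms ! k)) = c"
        using cs(1) ms(2) by (simp add: map_of_zip_nth)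
      moreover have "ms ! k \<in> B" using k cs(1) ms(1) by auto
      ultimately show ?thesis
        using lookup_comb[OF cs(1), of "ms ! k"] zero by simp
    qed
    moreover have "?h (const 0) = \<zero>\<^bsub>?Q\<^esub>"
      using h.hom_zero by (simp only: poly_ring_simps const_0)
    ultimately have "\<forall>c\<in>set cs. ?h (const c) = \<zero>\<^bsub>?Q\<^esub>" by blast
    then have "set Ks' \<subseteq> {\<zero>\<^bsub>?Q\<^esub>}"
      unfolding cs(2) set_map by blast
    then show "set (take (length (map ?h ps)) Ks) \<subseteq> {\<zero>\<^bsub>?Q\<^esub>}"
      using Ks'(1) by blast
  qed
  then have "h.S.dimension (length (map ?h ps)) K (h.S.Span K (map ?h ps))"
    by (rule h.S.dimension_independent)
  moreover have "h.S.Span K (map ?h ps) = ?h ` homogeneous_part n i"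
  proof -
    have "h.S.Span K (map ?h ps) = {h.S.combine Ks (map ?h ps) |Ks. length Ks = length (map ?h ps) \<and> set Ks \<subseteq> K}"
      by (rule h.S.Span_eq_combine_set_length_version[OF K carr_Q])
    also have "\<dots> = ?h ` homogeneous_part n i"
    proof (intro equalityI subsetI)
      fix x assume "x \<in> {h.S.combine Ks (map ?h ps) |Ks. length Ks = length (map ?h ps) \<and> set Ks \<subseteq> K}"
      then obtain Ks where "x = h.S.combine Ks (map ?h ps)" "length Ks = length ms" "set Ks \<subseteq> K"
        by (auto simp: len_ps)
      then obtain cs where "length cs = length ms" "x = ?h (comb cs)"
        using K_lists comb by metis
      then show "x \<in> ?h ` homogeneous_part n i" using supp_hom comb_supp by blast
    next
      fix x assume "x \<in> ?h ` homogeneous_part n i"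
      then obtain p where p: "x = ?h p" "p \<in> homogeneous_part n i" by blast
      then obtain q where q: "q \<in> supported (\<lambda>m. m \<in> B)" "p - q \<in> J" using spanning by blast
      then obtain cs where cs: "length cs = length ms" "q = comb cs" using supp_comb by blast
      have "x = h.S.combine (map ?h (map const cs)) (map ?h ps)"
        using p q cs comb coset_eq[of p q] supp_hom[OF q(1)] by (auto dest: homogeneous_part_subset_carrier)
      then show "x \<in> {h.S.combine Ks (map ?h ps) |Ks. length Ks = length (map ?h ps) \<and> set Ks \<subseteq> K}"
        using cs(1) by (auto simp: len_ps K_def intro!: exI[of _ "map ?h (map const cs)"])
    qed
    finally show ?thesis .
  qed
  ultimately have "(h.S.dim over K) (?h ` homogeneous_part n i) = length ms"
    using h.S.dimI[OF K] by (simp add: len_ps)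
  then show ?thesis
    by (simp add: quot_dim_def over_def K_def image_image ms(3))
qed

section \<open>Artin monomials span the coinvariant algebra\<close>

text \<open>
  Artin's monomials: those dividing \<open>x\<^sub>1\<close> to the power \<open>n - 1\<close> times \<open>x\<^sub>2\<close> to the power
  \<open>n - 2\<close>, and so on.
\<close>

definition artin :: "nat \<Rightarrow> monomial \<Rightarrow> bool"
  where "artin n m \<longleftrightarrow> Poly_Mapping.keys m \<subseteq> {1..n} \<and> (\<forall>j\<in>{1..n}. Poly_Mapping.lookup m j \<le> n - j)"

definition sym_gens :: "nat \<Rightarrow> nat \<Rightarrow> cpoly set"
  where "sym_gens n e = (if e \<in> {1..n} then {esym e {1..n}} else {})"

lemma esym_0: "finite S \<Longrightarrow> esym 0 S = 1"
proof -
  assume "finite S"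
  then have "{T. T \<subseteq> S \<and> card T = 0} = {{}}" by (auto dest: finite_subset)
  then show ?thesis by (simp add: esym_def)
qed

lemma esym_eq_0: "finite S \<Longrightarrow> card S < i \<Longrightarrow> esym i S = 0"
proof -
  assume S: "finite S" "card S < i"
  have "card T \<noteq> i" if "T \<subseteq> S" for T using card_mono[OF S(1) that] S(2) by simp
  then have "{T. T \<subseteq> S \<and> card T = i} = {}" by blast
  then show ?thesis unfolding esym_def by (simp only: sum.empty)
qed

lemma esym_insert:
  assumes "finite S" "a \<notin> S"
  shows "esym (Suc i) (insert a S) = esym (Suc i) S + var a * esym i S"
proof -
  let ?A = "{T. T \<subseteq> S \<and> card T = Suc i}" and ?B = "{T. T \<subseteq> S \<and> card T = i}"
  have fin: "finite T" if "T \<subseteq> S" for T using that assms(1) finite_subset by blast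
  have "{T. T \<subseteq> insert a S \<and> card T = Suc i} = ?A \<union> insert a ` ?B"
  proof (intro equalityI subsetI)
    fix T assume T: "T \<in> {T. T \<subseteq> insert a S \<and> card T = Suc i}"
    show "T \<in> ?A \<union> insert a ` ?B"
    proof (cases "a \<in> T")
      case True
      then have "T = insert a (T - {a})" "T - {a} \<in> ?B"
        using T by (auto simp: card_Diff_singleton)
      then show ?thesis by blast
    qed (use T in auto)
  next
    fix T assume "T \<in> ?A \<union> insert a ` ?B"
    then show "T \<in> {T. T \<subseteq> insert a S \<and> card T = Suc i}"
    proof
      assume "T \<in> insert a ` ?B"
      then obtain U where U: "T = insert a U" "U \<subseteq> S" "card U = i" by blast
      moreover have "a \<notin> U" using U assms(2) by blast
      ultimately show ?thesis using fin[of U] by auto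
    qed auto
  qed
  moreover have "inj_on (insert a) ?B"
    using assms(2) by (intro inj_onI) (metis (mono_tags, lifting) insert_ident mem_Collect_eq subsetD)
  moreover have "?A \<inter> insert a ` ?B = {}" using assms(2) by auto
  moreover have "(\<Prod>j\<in>insert a T. var j) = var a * (\<Prod>j\<in>T. var j)" if "T \<in> ?B" for T
    using that assms(2) fin[of T] by (subst prod.insert) auto
  ultimately show ?thesis
    using assms(1) by (simp add: esym_def sum.union_disjoint sum.reindex sum_distrib_left)
qed

lemma esym_homogeneous:
  assumes "S \<subseteq> {1..n}"
  shows "esym i S \<in> homogeneous_part n i"
proof -
  have prod_hom: "(\<Prod>j\<in>T. var j) \<in> homogeneous_part n (card T)" if "finite T" "T \<subseteq> {1..n}" for T
    using that
  proof (induction T rule: finite_induct)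
    case (insert a T)
    then show ?case
      using homogeneous_part_mult[OF var_homogeneous, of a n "\<Prod>j\<in>T. var j" "card T"] by simp
  qed (use const_homogeneous[of 1 n] in simp)
  have "(\<Prod>j\<in>T. var j) \<in> homogeneous_part n i" if "T \<in> {T. T \<subseteq> S \<and> card T = i}" for T
    using prod_hom[of T] that assms finite_subset[of T "{1..n}"] by auto
  then show ?thesis
    unfolding esym_def homogeneous_part_eq by (rule supported_sum)
qed

lemma sym_gens_homogeneous: "sym_gens n e \<subseteq> homogeneous_part n e"
  by (auto simp: sym_gens_def intro: esym_homogeneous)

text \<open>
  The complete homogeneous symmetric polynomial of degree \<open>i\<close> in the variables with indices \<open>1, \<dots>, j\<close>:
  a monomial either avoids the last variable or is divisible by it.
\<close>

fun complete_sym :: "nat \<Rightarrow> nat \<Rightarrow> cpoly"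
  where
    "complete_sym 0 j = 1"
  | "complete_sym (Suc i) 0 = 0"
  | "complete_sym (Suc i) (Suc j) = complete_sym (Suc i) j + var (Suc j) * complete_sym i (Suc j)"

text \<open>
  Both terms satisfy the same recursion when a variable is moved from the second group to the first,
  and for \<open>j = 0\<close> the elementary symmetric polynomial of positive degree lies in the ideal.
\<close>

lemma signed_esym_congruent_complete_sym:
  assumes "j \<le> n"
  shows "const ((-1) ^ i) * esym i {Suc j..n} - complete_sym i j \<in> graded_span n (sym_gens n) i"
  using assms
proof (induction i j rule: complete_sym.induct)
  case (1 j)
  then show ?case by (simp add: esym_0 graded_span.zero)
next
  case (2 i)
  show ?case
  proof (cases "Suc i \<le> n")
    case True
    then have "esym (Suc i) {Suc 0..n} \<in> graded_span n (sym_gens n) (Suc i)"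
      by (intro graded_span_generator) (simp add: sym_gens_def)
    then show ?thesis using graded_span_scale by auto
  qed (simp add: esym_eq_0 graded_span.zero)
next
  case (3 i j)
  have interval: "{Suc j..n} = insert (Suc j) {Suc (Suc j)..n}" using "3.prems" by auto
  have "esym (Suc i) {Suc j..n} = esym (Suc i) {Suc (Suc j)..n} + var (Suc j) * esym i {Suc (Suc j)..n}"
    unfolding interval by (rule esym_insert) auto
  then have split: "const ((-1) ^ Suc i) * esym (Suc i) {Suc (Suc j)..n} - complete_sym (Suc i) (Suc j)
      = (const ((-1) ^ Suc i) * esym (Suc i) {Suc j..n} - complete_sym (Suc i) j)
        + var (Suc j) * (const ((-1) ^ i) * esym i {Suc (Suc j)..n} - complete_sym i (Suc j))"
    by (simp add: algebra_simps const_def single_uminus)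
  have "var (Suc j) * (const ((-1) ^ i) * esym i {Suc (Suc j)..n} - complete_sym i (Suc j))
      \<in> graded_span n (sym_gens n) (Suc i)"
    using graded_span_mult[OF 3(2) var_homogeneous[of "Suc j"]] "3.prems" by simp
  then show ?case unfolding split using 3 by (intro graded_span_add) auto
qed

lemma complete_sym_supported:
  "complete_sym i j \<in> supported (\<lambda>m. Poly_Mapping.keys m \<subseteq> {1..j} \<and> mon_degree m = i \<and>
     mon_weight (\<lambda>j. j) m \<le> j * i)"
proof (induction i j rule: complete_sym.induct)
  case (1 j)
  show ?case by (simp add: supported_def mon_weight_def)
next
  case (3 i j)
  have "complete_sym (Suc i) j \<in> supported (\<lambda>m. Poly_Mapping.keys m \<subseteq> {1..Suc j} \<and> mon_degree m = Suc i \<and>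
     mon_weight (\<lambda>j. j) m \<le> Suc j * Suc i)"
    using 3(1) by (rule supported_mono) auto
  moreover have "var (Suc j) * complete_sym i (Suc j)
    \<in> supported (\<lambda>m. Poly_Mapping.keys m \<subseteq> {1..Suc j} \<and> mon_degree m = Suc i \<and> mon_weight (\<lambda>j. j) m \<le> Suc j * Suc i)"
    by (rule supported_mult[OF _ 3(2), where P = "\<lambda>m. m = Poly_Mapping.single (Suc j) 1"])
      (auto simp: var_def mon_degree_add mon_weight_add intro!: supported_single
        dest!: subsetD[OF Poly_Mapping.keys_add])
  ultimately show ?case by (auto intro: supported_add)
qed simp

text \<open>
  Among the monomials of degree \<open>i\<close> in \<open>x\<^sub>1, \<dots>, x\<^sub>j\<close>, the power of \<open>x\<^sub>j\<close> is the only one of weight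
  \<open>j * i\<close>.
\<close>

lemma complete_sym_leading:
  "0 < j \<Longrightarrow> complete_sym i j - Poly_Mapping.single (Poly_Mapping.single j i) 1
    \<in> supported (\<lambda>m. Poly_Mapping.keys m \<subseteq> {1..j} \<and> mon_degree m = i \<and> mon_weight (\<lambda>j. j) m < j * i)"
proof (induction i j rule: complete_sym.induct)
  case (3 i j)
  let ?P = "\<lambda>m. Poly_Mapping.keys m \<subseteq> {1..Suc j} \<and> mon_degree m = Suc i \<and> mon_weight (\<lambda>j. j) m < Suc j * Suc i"
  let ?x = "\<lambda>i. Poly_Mapping.single (Poly_Mapping.single (Suc j) i) (1::complex)"
  have "complete_sym (Suc i) j \<in> supported ?P"
  proof (rule supported_mono[OF complete_sym_supported])
    fix m assume m: "Poly_Mapping.keys m \<subseteq> {1..j} \<and> mon_degree m = Suc i \<and> mon_weight (\<lambda>j. j) m \<le> j * Suc i"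
    have "j * Suc i < Suc j * Suc i" by simp
    then have "mon_weight (\<lambda>j. j) m < Suc j * Suc i" using m le_less_trans by blast
    then show "?P m" using m by auto
  qed
  then have "complete_sym (Suc i) j + var (Suc j) * (complete_sym i (Suc j) - ?x i) \<in> supported ?P"
  proof (rule supported_add)
    show "var (Suc j) * (complete_sym i (Suc j) - ?x i) \<in> supported ?P"
      by (rule supported_mult[OF _ 3(2), where P = "\<lambda>m. m = Poly_Mapping.single (Suc j) 1"])
        (auto simp: var_def mon_degree_add mon_weight_add intro!: supported_single
          dest!: subsetD[OF Poly_Mapping.keys_add])
  qed
  moreover have "complete_sym (Suc i) (Suc j) - ?x (Suc i)
      = complete_sym (Suc i) j + var (Suc j) * (complete_sym i (Suc j) - ?x i)"
    by (simp add: algebra_simps var_def mult_single single_add[symmetric])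
  ultimately show ?case by (simp only:)
qed simp_all

text \<open>
  The reduction described at the beginning, by induction on the weight in which the variable of
  index \<open>j\<close> counts \<open>j\<close>.
\<close>

lemma artin_monomials_span:
  assumes "p \<in> homogeneous_part n d"
  obtains q h where "q \<in> supported (\<lambda>m. artin n m \<and> mon_degree m = d)"
    "h \<in> graded_span n (sym_gens n) d" "p = q + h"
proof -
  define V where "V = {q + h |q h. q \<in> supported (\<lambda>m. artin n m \<and> mon_degree m = d)
    \<and> h \<in> graded_span n (sym_gens n) d}"
  have V_I: "q + h \<in> V" if "q \<in> supported (\<lambda>m. artin n m \<and> mon_degree m = d)"
      "h \<in> graded_span n (sym_gens n) d" for q h
    using that unfolding V_def by blast
  have V_E: "\<exists>q h. p = q + h \<and> q \<in> supported (\<lambda>m. artin n m \<and> mon_degree m = d)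
      \<and> h \<in> graded_span n (sym_gens n) d" if "p \<in> V" for p
    using that unfolding V_def by blast
  have V_0: "0 \<in> V" using V_I[OF supported_0 graded_span.zero] by simp
  have V_add: "p + q \<in> V" if pq: "p \<in> V" "q \<in> V" for p q
  proof -
    obtain p1 p2 q1 q2 where *: "p = p1 + p2" "q = q1 + q2"
      "p1 \<in> supported (\<lambda>m. artin n m \<and> mon_degree m = d)" "p2 \<in> graded_span n (sym_gens n) d"
      "q1 \<in> supported (\<lambda>m. artin n m \<and> mon_degree m = d)" "q2 \<in> graded_span n (sym_gens n) d"
      using V_E[OF pq(1)] V_E[OF pq(2)] by blast
    then have "(p1 + q1) + (p2 + q2) \<in> V" by (intro V_I supported_add graded_span_add)
    then show ?thesis by (simp add: * algebra_simps)
  qed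
  have V_scale: "const c * p \<in> V" if p: "p \<in> V" for c p
  proof -
    obtain q h where *: "p = q + h" "q \<in> supported (\<lambda>m. artin n m \<and> mon_degree m = d)"
      "h \<in> graded_span n (sym_gens n) d"
      using V_E[OF p] by blast
    then have "const c * q + const c * h \<in> V" by (intro V_I supported_scale graded_span_scale)
    then show ?thesis by (simp add: * algebra_simps)
  qed
  have V_span: "h \<in> V" if "h \<in> graded_span n (sym_gens n) d" for h
    using V_I[OF supported_0 that] by simp
  have V_monomial: "Poly_Mapping.single m 1 \<in> V"
    if "Poly_Mapping.keys m \<subseteq> {1..n} \<and> mon_degree m = d" for m
    using that
  proof (induction "mon_weight (\<lambda>j. j) m" arbitrary: m rule: less_induct)
    case less
    show ?case
    proof (cases "artin n m")
      case True
      then have "Poly_Mapping.single m 1 \<in> supported (\<lambda>m. artin n m \<and> mon_degree m = d)"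
        using less.prems by (intro supported_single) simp
      then show ?thesis using V_I[OF _ graded_span.zero] by fastforce
    next
      case False
      then obtain j where j: "j \<in> {1..n}" "n - j < Poly_Mapping.lookup m j"
        using less.prems by (auto simp: artin_def not_le)
      \<comment> \<open>The elementary symmetric polynomial of this degree in the \<open>n - j\<close> last variables vanishes.\<close>
      define t where "t = Suc (n - j)"
      define m' where "m' = m - Poly_Mapping.single j t"
      have m: "m = m' + Poly_Mapping.single j t"
        using j by (intro poly_mapping_eqI) (auto simp: m'_def t_def lookup_add lookup_minus lookup_single when_def)
      have m'_keys: "Poly_Mapping.keys m' \<subseteq> {1..n}"
        using less.prems by (auto simp: m'_def in_keys_iff lookup_minus)
      have m'_degree: "mon_degree m' + t = d"
        using less.prems by (simp add: m mon_degree_add)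
      let ?x = "Poly_Mapping.single m' (1::complex)"
      let ?L = "complete_sym t j - Poly_Mapping.single (Poly_Mapping.single j t) 1"
      have "complete_sym t j \<in> graded_span n (sym_gens n) t"
        using graded_span_uminus[OF signed_esym_congruent_complete_sym[of j n t]] j
        by (simp add: esym_eq_0 t_def)
      moreover have "?x \<in> homogeneous_part n (mon_degree m')"
        using m'_keys unfolding homogeneous_part_eq by (intro supported_single) simp
      ultimately have "?x * complete_sym t j \<in> graded_span n (sym_gens n) d"
        using graded_span_mult m'_degree by metis
      moreover have "?x * ?L \<in> V"
      proof (rule supported_induct[OF _ V_0 V_add V_scale])
        let ?P = "\<lambda>k. Poly_Mapping.keys k \<subseteq> {1..n} \<and> mon_degree k = d \<and> mon_weight (\<lambda>j. j) k < mon_weight (\<lambda>j. j) m"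
        show "?x * ?L \<in> supported ?P"
        proof (rule supported_mult[OF supported_single[of "\<lambda>k. k = m'"] complete_sym_leading[of j t]])
          fix a b assume a: "a = m'" and b: "Poly_Mapping.keys b \<subseteq> {1..j} \<and> mon_degree b = t \<and> mon_weight (\<lambda>j. j) b < j * t"
          have "Poly_Mapping.keys b \<subseteq> {1..n}" using b j by auto
          then show "?P (a + b)"
            using a b m'_keys m'_degree by (auto simp: m mon_degree_add mon_weight_add dest!: subsetD[OF Poly_Mapping.keys_add])
        qed (use j in auto)
        show "Poly_Mapping.single k 1 \<in> V" if "?P k" for k using that less.hyps by blast
      qed
      moreover have "Poly_Mapping.single m 1 = ?x * complete_sym t j + const (-1) * (?x * ?L)"
        by (simp add: m mult_single algebra_simps const_def single_uminus)
      ultimately show ?thesis using V_span V_add V_scale by metis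
    qed
  qed
  have "p \<in> V"
    using assms unfolding homogeneous_part_eq by (rule supported_induct[OF _ V_0 V_add V_scale V_monomial])
  then show ?thesis using that unfolding V_def by blast
qed

section \<open>Artin monomials as functions on the permutations\<close>

definition mon_value :: "(nat \<Rightarrow> complex) \<Rightarrow> monomial \<Rightarrow> complex"
  where "mon_value x m = (\<Prod>j\<in>Poly_Mapping.keys m. x j ^ Poly_Mapping.lookup m j)"

definition eval_at :: "(nat \<Rightarrow> complex) \<Rightarrow> cpoly \<Rightarrow> complex"
  where "eval_at x p = (\<Sum>m\<in>Poly_Mapping.keys p. Poly_Mapping.lookup p m * mon_value x m)"

lemma mon_value_superset:
  "finite A \<Longrightarrow> Poly_Mapping.keys m \<subseteq> A \<Longrightarrow> mon_value x m = (\<Prod>j\<in>A. x j ^ Poly_Mapping.lookup m j)"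
  unfolding mon_value_def by (rule prod.mono_neutral_left) (auto simp: in_keys_iff)

lemma mon_value_add: "mon_value x (a + b) = mon_value x a * mon_value x b"
proof -
  let ?A = "Poly_Mapping.keys a \<union> Poly_Mapping.keys b"
  show ?thesis
    using mon_value_superset[of ?A a x] mon_value_superset[of ?A b x]
      mon_value_superset[of ?A "a + b" x] Poly_Mapping.keys_add[of a b]
    by (simp add: lookup_add prod.distrib power_add)
qed

lemma eval_at_superset:
  "finite A \<Longrightarrow> Poly_Mapping.keys p \<subseteq> A \<Longrightarrow> eval_at x p = (\<Sum>m\<in>A. Poly_Mapping.lookup p m * mon_value x m)"
  unfolding eval_at_def by (rule sum.mono_neutral_left) (auto simp: in_keys_iff)

lemma eval_at_0 [simp]: "eval_at x 0 = 0"
  by (simp add: eval_at_def)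

lemma eval_at_add: "eval_at x (p + q) = eval_at x p + eval_at x q"
proof -
  let ?A = "Poly_Mapping.keys p \<union> Poly_Mapping.keys q"
  show ?thesis
    using eval_at_superset[of ?A p x] eval_at_superset[of ?A q x]
      eval_at_superset[of ?A "p + q" x] Poly_Mapping.keys_add[of p q]
    by (simp add: lookup_add sum.distrib distrib_right)
qed

lemma eval_at_single: "eval_at x (Poly_Mapping.single m c) = c * mon_value x m"
  by (simp add: eval_at_def)

lemma eval_at_scale: "eval_at x (const c * p) = c * eval_at x p"
proof -
  have "Poly_Mapping.keys (const c * p) \<subseteq> Poly_Mapping.keys p"
    by (auto simp: in_keys_iff lookup_const_mult)
  then show ?thesis
    using eval_at_superset[of "Poly_Mapping.keys p" "const c * p" x]
    by (simp add: eval_at_def lookup_const_mult sum_distrib_left mult.assoc)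
qed

lemma eval_at_const: "eval_at x (const c) = c"
  by (simp add: const_def eval_at_single mon_value_def)

lemma eval_at_minus: "eval_at x (p - q) = eval_at x p - eval_at x q"
  using eval_at_add[of x "p - q" q] by simp

lemma eval_at_mult: "eval_at x (p * q) = eval_at x p * eval_at x q"
proof -
  let ?P = "{p. eval_at x (p * q) = eval_at x p * eval_at x q}"
  have "p \<in> ?P"
  proof (rule supported_induct[of p "\<lambda>_. True"])
    fix m
    let ?Q = "{q. eval_at x (Poly_Mapping.single m 1 * q) = eval_at x (Poly_Mapping.single m 1) * eval_at x q}"
    have "q \<in> ?Q"
      by (rule supported_induct[of q "\<lambda>_. True"])
        (auto simp: supported_def distrib_left eval_at_add eval_at_scale eval_at_single mult_single
          mon_value_add mult.left_commute[of _ "const c" for c])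
    then show "Poly_Mapping.single m 1 \<in> ?P" by simp
  qed (auto simp: supported_def distrib_right eval_at_add eval_at_scale mult.assoc)
  then show ?thesis by simp
qed

lemma eval_at_1 [simp]: "eval_at x 1 = 1"
  by (simp add: eval_at_def mon_value_def)

lemma eval_at_sum: "eval_at x (sum f A) = (\<Sum>a\<in>A. eval_at x (f a))"
  by (induction A rule: infinite_finite_induct) (simp_all add: eval_at_add)

lemma eval_at_prod: "eval_at x (prod f A) = (\<Prod>a\<in>A. eval_at x (f a))"
  by (induction A rule: infinite_finite_induct) (simp_all add: eval_at_mult)

lemma eval_at_var: "eval_at x (var j) = x j"
  by (simp add: var_def eval_at_single mon_value_def)

lemma eval_at_esym: "eval_at x (esym i S) = (\<Sum>T\<in>{T. T \<subseteq> S \<and> card T = i}. \<Prod>j\<in>T. x j)"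
  by (simp add: esym_def eval_at_sum eval_at_prod eval_at_var)

text \<open>
  Permuting the coordinates of a point permutes the summands.
\<close>

lemma esym_eval_permuted:
  assumes "bij_betw \<pi> S S"
  shows "eval_at (\<lambda>j. of_nat (\<pi> j)) (esym i S) = eval_at of_nat (esym i S)"
proof -
  let ?A = "{T. T \<subseteq> S \<and> card T = i}"
  have inj: "inj_on \<pi> T" if "T \<subseteq> S" for T
    using assms that by (meson bij_betw_imp_inj_on inj_on_subset)
  have Pow: "bij_betw (image \<pi>) (Pow S) (Pow S)" using assms by (rule bij_betw_Pow)
  have "image \<pi> ` ?A = ?A"
  proof (intro equalityI subsetI)
    fix T assume "T \<in> image \<pi> ` ?A"
    then obtain U where U: "U \<subseteq> S" "card U = i" "T = \<pi> ` U" by blast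
    then have "T \<subseteq> S" using bij_betw_imp_surj_on[OF assms] by blast
    then show "T \<in> ?A" using U card_image[OF inj[OF U(1)]] by simp
  next
    fix T assume T: "T \<in> ?A"
    then have "T \<in> image \<pi> ` Pow S" by (simp only: bij_betw_imp_surj_on[OF Pow]) blast
    then obtain U where U: "U \<subseteq> S" "T = \<pi> ` U" by blast
    then have "card U = i" using T card_image[OF inj[OF U(1)]] by simp
    then show "T \<in> image \<pi> ` ?A" using U by blast
  qed
  moreover have "inj_on (image \<pi>) ?A"
    using bij_betw_imp_inj_on[OF Pow] by (rule inj_on_subset) auto
  ultimately have bij: "bij_betw (image \<pi>) ?A ?A" by (simp add: bij_betw_def)
  have "(\<Sum>T\<in>?A. \<Prod>j\<in>T. of_nat (\<pi> j)) = (\<Sum>T\<in>?A. \<Prod>j\<in>\<pi> ` T. of_nat j :: complex)"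
    by (intro sum.cong refl) (simp add: prod.reindex[OF inj])
  also have "\<dots> = (\<Sum>T\<in>?A. \<Prod>j\<in>T. of_nat j)"
    by (rule sum.reindex_bij_betw[OF bij])
  finally show ?thesis by (simp add: eval_at_esym)
qed

text \<open>
  Replacing each generator \<open>e\<^sub>b\<close> in \<open>h = \<Sum> g * e\<^sub>b\<close> by its constant value on the permutations lowers the
  degree, since \<open>b > 0\<close>.
\<close>

lemma symmetric_ideal_lowers_degree:
  assumes "h \<in> graded_span n (sym_gens n) d"
  shows "\<exists>r\<in>supported (\<lambda>m. Poly_Mapping.keys m \<subseteq> {1..n} \<and> mon_degree m < d).
    \<forall>\<pi>. bij_betw \<pi> {1..n} {1..n} \<longrightarrow> eval_at (\<lambda>j. of_nat (\<pi> j)) h = eval_at (\<lambda>j. of_nat (\<pi> j)) r"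
  using assms
proof induction
  case zero
  show ?case by (intro bexI[of _ 0]) auto
next
  case (step p g a f b)
  then obtain r where r: "r \<in> supported (\<lambda>m. Poly_Mapping.keys m \<subseteq> {1..n} \<and> mon_degree m < d)"
    "\<And>\<pi>. bij_betw \<pi> {1..n} {1..n} \<Longrightarrow> eval_at (\<lambda>j. of_nat (\<pi> j)) p = eval_at (\<lambda>j. of_nat (\<pi> j)) r"
    by blast
  have f: "f = esym b {1..n}" "b > 0" using step.hyps by (auto simp: sym_gens_def split: if_splits)
  let ?r = "r + const (eval_at of_nat f) * g"
  have "g \<in> supported (\<lambda>m. Poly_Mapping.keys m \<subseteq> {1..n} \<and> mon_degree m < d)"
    using step.hyps f(2) unfolding homogeneous_part_eq by (auto intro: supported_mono)
  then have "?r \<in> supported (\<lambda>m. Poly_Mapping.keys m \<subseteq> {1..n} \<and> mon_degree m < d)"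
    using r(1) by (intro supported_add supported_scale)
  moreover have "eval_at (\<lambda>j. of_nat (\<pi> j)) (p + g * f) = eval_at (\<lambda>j. of_nat (\<pi> j)) ?r"
    if "bij_betw \<pi> {1..n} {1..n}" for \<pi>
    using r(2)[OF that] esym_eval_permuted[OF that] by (simp add: eval_at_add eval_at_mult eval_at_const f(1))
  ultimately show ?case by blast
qed

text \<open>
  Reduce the top component to Artin monomials; the error lies in the symmetric ideal and has on the
  permutations the values of a polynomial of smaller degree, which goes to the rest.
\<close>

lemma artin_monomials_span_functions:
  assumes "p \<in> supported (\<lambda>m. Poly_Mapping.keys m \<subseteq> {1..n} \<and> mon_degree m < D)"
  shows "\<exists>q\<in>supported (\<lambda>m. artin n m \<and> mon_degree m < D).
    \<forall>\<pi>. bij_betw \<pi> {1..n} {1..n} \<longrightarrow> eval_at (\<lambda>j. of_nat (\<pi> j)) p = eval_at (\<lambda>j. of_nat (\<pi> j)) q"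
  using assms
proof (induction D arbitrary: p)
  case 0
  then have "p = 0" by (auto simp: supported_def)
  then show ?case by (intro bexI[of _ 0]) auto
next
  case (Suc D)
  let ?top = "hom_component D p"
  have "?top \<in> homogeneous_part n D"
    using Suc.prems by (intro hom_component_in) (auto simp: poly_carrier_eq intro: supported_mono)
  then obtain q h where q: "q \<in> supported (\<lambda>m. artin n m \<and> mon_degree m = D)"
    and h: "h \<in> graded_span n (sym_gens n) D" and top: "?top = q + h"
    by (rule artin_monomials_span)
  obtain r where r: "r \<in> supported (\<lambda>m. Poly_Mapping.keys m \<subseteq> {1..n} \<and> mon_degree m < D)"
    "\<And>\<pi>. bij_betw \<pi> {1..n} {1..n} \<Longrightarrow> eval_at (\<lambda>j. of_nat (\<pi> j)) h = eval_at (\<lambda>j. of_nat (\<pi> j)) r"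
    using symmetric_ideal_lowers_degree[OF h] by blast
  have "p - ?top \<in> supported (\<lambda>m. Poly_Mapping.keys m \<subseteq> {1..n} \<and> mon_degree m < D)"
    unfolding supported_def
  proof (intro CollectI ballI)
    fix m assume "m \<in> Poly_Mapping.keys (p - ?top)"
    then have "m \<in> Poly_Mapping.keys p" "mon_degree m \<noteq> D"
      by (auto simp: in_keys_iff lookup_minus lookup_hom_component split: if_splits)
    moreover from this(1) have "Poly_Mapping.keys m \<subseteq> {1..n}" "mon_degree m < Suc D"
      using Suc.prems by (simp_all add: supported_def)
    ultimately show "Poly_Mapping.keys m \<subseteq> {1..n} \<and> mon_degree m < D" by simp
  qed
  then obtain s where s: "s \<in> supported (\<lambda>m. artin n m \<and> mon_degree m < D)"
    "\<And>\<pi>. bij_betw \<pi> {1..n} {1..n} \<Longrightarrow> eval_at (\<lambda>j. of_nat (\<pi> j)) ((p - ?top) + r) = eval_at (\<lambda>j. of_nat (\<pi> j)) s"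
    using Suc.IH[OF supported_add[OF _ r(1)]] by blast
  have "q + s \<in> supported (\<lambda>m. artin n m \<and> mon_degree m < Suc D)"
    using q s(1) by (intro supported_add) (auto intro: supported_mono)
  moreover have "eval_at (\<lambda>j. of_nat (\<pi> j)) p = eval_at (\<lambda>j. of_nat (\<pi> j)) (q + s)"
    if "bij_betw \<pi> {1..n} {1..n}" for \<pi>
  proof -
    have "p = q + h + (p - ?top)" using top by simp
    from arg_cong[OF this] have "eval_at (\<lambda>j. of_nat (\<pi> j)) p = eval_at (\<lambda>j. of_nat (\<pi> j)) (q + h + (p - ?top))" .
    then show ?thesis using r(2)[OF that] s(2)[OF that] by (simp add: eval_at_add add_ac)
  qed
  ultimately show ?case by blast
qed

text \<open>
  The coordinates are eliminated from the last to the first. Once \<open>x\<^sub>1, \<dots>, x\<^sub>r\<close> are chosen, there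
  are \<open>n - r\<close> values left for the next one, which occurs with exponent at most \<open>n - r - 1\<close>: a polynomial
  in one variable with more roots than its degree. So all its coefficients vanish, and they are
  functions of \<open>x\<^sub>1, \<dots>, x\<^sub>r\<close> of the same shape.
\<close>

lemma staircase_interpolation:
  fixes c :: "(nat \<Rightarrow> nat) \<Rightarrow> complex"
  assumes "r \<le> n"
    and "\<And>x. inj_on x {1..r} \<Longrightarrow> x ` {1..r} \<subseteq> {1..n} \<Longrightarrow>
      (\<Sum>a\<in>(\<Pi>\<^sub>E j\<in>{1..r}. {..n - j}). c a * (\<Prod>j\<in>{1..r}. of_nat (x j) ^ a j)) = 0"
    and "a \<in> (\<Pi>\<^sub>E j\<in>{1..r}. {..n - j})"
  shows "c a = 0"
  using assms
proof (induction r arbitrary: c a)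
  case 0
  then show ?case by simp
next
  case (Suc r)
  let ?E = "\<Pi>\<^sub>E j\<in>{1..r}. {..n - j}"
  have ivl: "{1..Suc r} = insert (Suc r) {1..r}" by auto
  have c_zero: "c (b(Suc r := t)) = 0" if t: "t \<le> n - Suc r" and b: "b \<in> ?E" for t b
  proof (rule Suc.IH[where c = "\<lambda>b. c (b(Suc r := t))" and a = b])
    fix x assume x: "inj_on x {1..r}" "x ` {1..r} \<subseteq> {1..n}"
    define C where "C t = (\<Sum>b\<in>?E. c (b(Suc r := t)) * (\<Prod>j\<in>{1..r}. of_nat (x j) ^ b j))" for t
    have roots: "(\<Sum>t\<le>n - Suc r. C t * of_nat y ^ t) = 0" if y: "y \<in> {1..n} - x ` {1..r}" for y
    proof -
      let ?x = "x(Suc r := y)"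
      have image: "?x ` {1..r} = x ` {1..r}" by (rule image_cong) auto
      have "inj_on ?x {1..r}" using x(1) by (rule inj_on_cong[THEN iffD1, rotated]) auto
      then have "inj_on ?x {1..Suc r}"
        using y unfolding ivl inj_on_insert by (simp add: image del: fun_upd_apply) simp
      moreover have "?x ` {1..Suc r} \<subseteq> {1..n}"
        using x(2) y unfolding ivl image_insert image by simp
      ultimately have "(\<Sum>a\<in>(\<Pi>\<^sub>E j\<in>{1..Suc r}. {..n - j}). c a * (\<Prod>j\<in>{1..Suc r}. of_nat (?x j) ^ a j)) = 0"
        by (rule Suc.prems(2))
      also have "(\<Sum>a\<in>(\<Pi>\<^sub>E j\<in>{1..Suc r}. {..n - j}). c a * (\<Prod>j\<in>{1..Suc r}. of_nat (?x j) ^ a j))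
        = (\<Sum>(t, b)\<in>{..n - Suc r} \<times> ?E. c (b(Suc r := t)) * (\<Prod>j\<in>{1..Suc r}. of_nat (?x j) ^ (b(Suc r := t)) j))"
        unfolding ivl PiE_insert_eq
        by (subst sum.reindex) (auto intro!: inj_combinator sum.cong)
      also have "\<dots> = (\<Sum>(t, b)\<in>{..n - Suc r} \<times> ?E.
          (c (b(Suc r := t)) * (\<Prod>j\<in>{1..r}. of_nat (x j) ^ b j)) * of_nat y ^ t)"
      proof (rule sum.cong, rule refl, clarify)
        fix t b
        have "(\<Prod>j\<in>{1..r}. of_nat (?x j) ^ (b(Suc r := t)) j) = (\<Prod>j\<in>{1..r}. of_nat (x j) ^ b j :: complex)"
          by (rule prod.cong) auto
        then show "c (b(Suc r := t)) * (\<Prod>j\<in>{1..Suc r}. of_nat (?x j) ^ (b(Suc r := t)) j)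
          = c (b(Suc r := t)) * (\<Prod>j\<in>{1..r}. of_nat (x j) ^ b j) * of_nat y ^ t"
          unfolding ivl by (subst prod.insert) auto
      qed
      also have "\<dots> = (\<Sum>t\<le>n - Suc r. C t * of_nat y ^ t)"
        by (simp add: sum.cartesian_product[symmetric] C_def sum_distrib_right)
      finally show ?thesis by simp
    qed
    have "C t = 0"
    proof (rule ccontr)
      assume "C t \<noteq> 0"
      then have bound: "finite {z. (\<Sum>t\<le>n - Suc r. C t * z ^ t) = 0}"
          "card {z. (\<Sum>t\<le>n - Suc r. C t * z ^ t) = 0} \<le> n - Suc r"
        using t polyfun_rootbound[of C t "n - Suc r"] by blast+
      have "of_nat ` ({1..n} - x ` {1..r}) \<subseteq> {z. (\<Sum>t\<le>n - Suc r. C t * z ^ t) = 0}"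
        using roots by auto
      then have "card ((of_nat :: nat \<Rightarrow> complex) ` ({1..n} - x ` {1..r})) \<le> n - Suc r"
        using card_mono[OF bound(1)] bound(2) by (meson le_trans)
      moreover have "card ((of_nat :: nat \<Rightarrow> complex) ` ({1..n} - x ` {1..r})) = n - r"
        using x(2) card_image[OF x(1)] by (simp add: card_image[OF inj_on_subset[OF inj_of_nat]] card_Diff_subset)
      ultimately show False using Suc.prems(1) by simp
    qed
    then show "(\<Sum>b\<in>?E. c (b(Suc r := t)) * (\<Prod>j\<in>{1..r}. of_nat (x j) ^ b j)) = 0"
      by (simp add: C_def)
  qed (use Suc.prems(1) b in auto)
  have "a \<in> (\<lambda>(y, g). g(Suc r := y)) ` ({..n - Suc r} \<times> ?E)"
    using Suc.prems(3) unfolding ivl PiE_insert_eq .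
  then show ?case using c_zero by auto
qed

definition artin_exponents :: "nat \<Rightarrow> (nat \<Rightarrow> nat) set"
  where "artin_exponents n = (\<Pi>\<^sub>E j\<in>{1..n}. {..n - j})"

definition monomial_of :: "nat \<Rightarrow> (nat \<Rightarrow> nat) \<Rightarrow> monomial"
  where "monomial_of n a = Abs_poly_mapping (\<lambda>j. a j when j \<in> {1..n})"

lemma lookup_monomial_of: "Poly_Mapping.lookup (monomial_of n a) j = (if j \<in> {1..n} then a j else 0)"
proof -
  have "finite {j. (a j when j \<in> {1..n}) \<noteq> 0}"
    by (rule finite_subset[of _ "{1..n}"]) (auto simp: when_def split: if_splits)
  then show ?thesis by (simp add: monomial_of_def when_def)
qed

lemma keys_monomial_of: "Poly_Mapping.keys (monomial_of n a) \<subseteq> {1..n}"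
  by (auto simp: in_keys_iff lookup_monomial_of split: if_splits)

lemma bij_betw_monomial_of: "bij_betw (monomial_of n) (artin_exponents n) {m. artin n m}"
proof (rule bij_betw_byWitness[where f' = "\<lambda>m. restrict (Poly_Mapping.lookup m) {1..n}"])
  show "\<forall>a\<in>artin_exponents n. restrict (Poly_Mapping.lookup (monomial_of n a)) {1..n} = a"
    by (auto simp: artin_exponents_def lookup_monomial_of fun_eq_iff PiE_def extensional_def restrict_def)
  show "\<forall>m\<in>{m. artin n m}. monomial_of n (restrict (Poly_Mapping.lookup m) {1..n}) = m"
    by (auto simp: artin_def lookup_monomial_of in_keys_iff intro!: poly_mapping_eqI)
  show "monomial_of n ` artin_exponents n \<subseteq> {m. artin n m}"
    using keys_monomial_of by (auto simp: artin_def artin_exponents_def lookup_monomial_of PiE_def Pi_def)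
  show "(\<lambda>m. restrict (Poly_Mapping.lookup m) {1..n}) ` {m. artin n m} \<subseteq> artin_exponents n"
    by (auto simp: artin_def artin_exponents_def)
qed

lemma artin_polynomial_vanishing:
  assumes f: "f \<in> supported (artin n)"
    and vanish: "\<And>\<pi>. bij_betw \<pi> {1..n} {1..n} \<Longrightarrow> eval_at (\<lambda>j. of_nat (\<pi> j)) f = 0"
  shows "f = 0"
proof (rule poly_mapping_eqI)
  fix m
  have fin: "finite {m. artin n m}"
    using bij_betw_finite[OF bij_betw_monomial_of[of n]] by (simp add: artin_exponents_def finite_PiE)
  have keys: "Poly_Mapping.keys f \<subseteq> {m. artin n m}" using f by (auto simp: supported_def)
  have zero: "Poly_Mapping.lookup f (monomial_of n a) = 0" if a: "a \<in> artin_exponents n" for a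
  proof (rule staircase_interpolation[of n n "\<lambda>a. Poly_Mapping.lookup f (monomial_of n a)"])
    fix x assume x: "inj_on x {1..n}" "x ` {1..n} \<subseteq> {1..n}"
    then have "bij_betw x {1..n} {1..n}"
      using endo_inj_surj[of "{1..n}" x] by (simp add: bij_betw_def)
    then have "0 = (\<Sum>m\<in>{m. artin n m}. Poly_Mapping.lookup f m * mon_value (\<lambda>j. of_nat (x j)) m)"
      using vanish eval_at_superset[OF fin keys] by metis
    also have "\<dots> = (\<Sum>a\<in>artin_exponents n. Poly_Mapping.lookup f (monomial_of n a)
        * mon_value (\<lambda>j. of_nat (x j)) (monomial_of n a))"
      by (rule sum.reindex_bij_betw[OF bij_betw_monomial_of, symmetric])
    also have "\<dots> = (\<Sum>a\<in>artin_exponents n. Poly_Mapping.lookup f (monomial_of n a)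
        * (\<Prod>j\<in>{1..n}. of_nat (x j) ^ a j))"
      by (simp add: mon_value_superset[OF finite_atLeastAtMost keys_monomial_of] lookup_monomial_of)
    finally show "(\<Sum>a\<in>(\<Pi>\<^sub>E j\<in>{1..n}. {..n - j}). Poly_Mapping.lookup f (monomial_of n a)
        * (\<Prod>j\<in>{1..n}. of_nat (x j) ^ a j)) = 0"
      by (simp add: artin_exponents_def)
  qed (use a in \<open>auto simp: artin_exponents_def\<close>)
  show "Poly_Mapping.lookup f m = Poly_Mapping.lookup 0 m"
  proof (cases "artin n m")
    case True
    then obtain a where "a \<in> artin_exponents n" "m = monomial_of n a"
      using bij_betw_imp_surj_on[OF bij_betw_monomial_of[of n]] by blast
    then show ?thesis using zero by simp
  next
    case False
    then show ?thesis using keys by (auto simp: in_keys_iff)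
  qed
qed

text \<open>
  On the permutations, \<open>f\<close> agrees with a combination \<open>q\<close> of Artin monomials of smaller degree; by
  \<open>artin_polynomial_vanishing\<close> it is equal to \<open>q\<close>, and the degrees are incompatible unless \<open>f = 0\<close>.
\<close>

lemma artin_monomials_independent:
  assumes f: "f \<in> supported (\<lambda>m. artin n m \<and> mon_degree m = d)"
    and h: "f \<in> graded_span n (sym_gens n) d"
  shows "f = 0"
proof -
  obtain r where r: "r \<in> supported (\<lambda>m. Poly_Mapping.keys m \<subseteq> {1..n} \<and> mon_degree m < d)"
    "\<And>\<pi>. bij_betw \<pi> {1..n} {1..n} \<Longrightarrow> eval_at (\<lambda>j. of_nat (\<pi> j)) f = eval_at (\<lambda>j. of_nat (\<pi> j)) r"
    using symmetric_ideal_lowers_degree[OF h] by blast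
  obtain q where q: "q \<in> supported (\<lambda>m. artin n m \<and> mon_degree m < d)"
    "\<And>\<pi>. bij_betw \<pi> {1..n} {1..n} \<Longrightarrow> eval_at (\<lambda>j. of_nat (\<pi> j)) r = eval_at (\<lambda>j. of_nat (\<pi> j)) q"
    using artin_monomials_span_functions[OF r(1)] by blast
  have "f - q = 0"
  proof (rule artin_polynomial_vanishing)
    show "f - q \<in> supported (artin n)"
      using f q(1) by (intro supported_diff) (auto intro: supported_mono)
  qed (simp add: eval_at_minus r(2) q(2))
  then have "Poly_Mapping.keys f = {}"
    using f q(1) by (fastforce simp: supported_def)
  then show ?thesis by simp
qed

section \<open>Counting Artin monomials by permutations\<close>

definition lehmer_code :: "nat \<Rightarrow> (nat \<Rightarrow> nat) \<Rightarrow> nat \<Rightarrow> nat"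
  where "lehmer_code n \<pi> = (\<lambda>a\<in>{1..n}. card {b\<in>{1..n}. a < b \<and> \<pi> b < \<pi> a})"

lemma sum_lehmer_code: "(\<Sum>a\<in>{1..n}. lehmer_code n \<pi> a) = card (inversions n \<pi>)"
proof -
  have "inversions n \<pi> = (SIGMA a:{1..n}. {b\<in>{1..n}. a < b \<and> \<pi> b < \<pi> a})"
    by (auto simp: inversions_def)
  then show ?thesis by (simp add: lehmer_code_def)
qed

lemma lehmer_code_in: "lehmer_code n \<pi> \<in> artin_exponents n"
proof -
  have "card {b\<in>{1..n}. a < b \<and> \<pi> b < \<pi> a} \<le> n - a" for a
    using card_mono[of "{a<..n}" "{b\<in>{1..n}. a < b \<and> \<pi> b < \<pi> a}"] by fastforce
  then show ?thesis by (auto simp: artin_exponents_def lehmer_code_def)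
qed

text \<open>
  The code entry at \<open>a\<close> is the rank of the value at \<open>a\<close> among the values not taken before, so the code
  determines the values one after the other.
\<close>

lemma lehmer_code_inj: "inj_on (lehmer_code n) {\<pi>. \<pi> permutes {1..n}}"
proof (rule inj_onI, clarify)
  fix \<pi> \<sigma> assume perm: "\<pi> permutes {1..n}" "\<sigma> permutes {1..n}"
    and code: "lehmer_code n \<pi> = lehmer_code n \<sigma>"
  have rank: "lehmer_code n \<tau> a = card {v \<in> {1..n} - \<tau> ` {1..<a}. v < \<tau> a}"
    if a: "a \<in> {1..n}" and \<tau>: "\<tau> permutes {1..n}" for \<tau> a
  proof -
    have "{v \<in> {1..n} - \<tau> ` {1..<a}. v < \<tau> a} = \<tau> ` {b\<in>{1..n}. a < b \<and> \<tau> b < \<tau> a}"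
    proof (intro equalityI subsetI)
      fix v assume v: "v \<in> {v \<in> {1..n} - \<tau> ` {1..<a}. v < \<tau> a}"
      then obtain b where b: "b \<in> {1..n}" "v = \<tau> b" using permutes_image[OF \<tau>] by blast
      moreover have "\<not> b < a" using v b by auto
      moreover have "b \<noteq> a" using v b by auto
      ultimately show "v \<in> \<tau> ` {b\<in>{1..n}. a < b \<and> \<tau> b < \<tau> a}" using v by auto
    next
      fix v assume "v \<in> \<tau> ` {b\<in>{1..n}. a < b \<and> \<tau> b < \<tau> a}"
      then obtain b where b: "b \<in> {1..n}" "a < b" "\<tau> b < \<tau> a" "v = \<tau> b" by blast
      moreover have "\<tau> b \<in> {1..n}" using permutes_in_image[OF \<tau>] b by blast
      moreover have "\<tau> b \<notin> \<tau> ` {1..<a}"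
        using b(2) by (auto simp: inj_eq[OF permutes_inj[OF \<tau>]])
      ultimately show "v \<in> {v \<in> {1..n} - \<tau> ` {1..<a}. v < \<tau> a}" by simp
    qed
    moreover have "inj_on \<tau> {b\<in>{1..n}. a < b \<and> \<tau> b < \<tau> a}"
      using permutes_inj[OF \<tau>] by (rule inj_on_subset) simp
    ultimately show ?thesis using a by (simp add: lehmer_code_def card_image)
  qed
  have agree: "\<pi> a = \<sigma> a" if "a \<in> {1..n}" for a
    using that
  proof (induction a rule: less_induct)
    case (less a)
    then have same: "\<pi> ` {1..<a} = \<sigma> ` {1..<a}" by (intro image_cong) auto
    let ?S = "{1..n} - \<sigma> ` {1..<a}"
    have card_eq: "card {v \<in> ?S. v < \<pi> a} = card {v \<in> ?S. v < \<sigma> a}"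
      using rank[OF less.prems perm(1)] rank[OF less.prems perm(2)] code same by simp
    have in_S: "\<tau> a \<in> {1..n} - \<tau> ` {1..<a}" if "\<tau> permutes {1..n}" for \<tau>
      using permutes_in_image[OF that, of a] less.prems by (auto simp: inj_eq[OF permutes_inj[OF that]])
    have not_less: "\<not> u < w" if "u \<in> ?S" "card {v \<in> ?S. v < u} = card {v \<in> ?S. v < w}" for u w
    proof
      assume "u < w"
      then have "{v \<in> ?S. v < u} \<subset> {v \<in> ?S. v < w}" using that(1) by auto
      then have "card {v \<in> ?S. v < u} < card {v \<in> ?S. v < w}" by (intro psubset_card_mono) auto
      then show False using that(2) by simp
    qed
    show ?case
      using not_less[OF _ card_eq] not_less[OF _ card_eq[symmetric]] in_S[OF perm(1)] in_S[OF perm(2)] same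
      by (metis linorder_neqE_nat)
  qed
  show "\<pi> = \<sigma>"
  proof
    fix a show "\<pi> a = \<sigma> a"
      using agree perm by (cases "a \<in> {1..n}") (auto simp: permutes_not_in)
  qed
qed

lemma finite_artin_exponents: "finite (artin_exponents n)"
  by (simp add: artin_exponents_def finite_PiE)

lemma card_artin_exponents: "card (artin_exponents n) = fact n"
proof -
  have "card (artin_exponents n) = (\<Prod>j\<in>{1..n}. Suc (n - j))"
    by (simp add: artin_exponents_def card_PiE)
  also have "\<dots> = \<Prod>{1..n}"
    by (rule prod.reindex_bij_witness[where i = "\<lambda>j. Suc n - j" and j = "\<lambda>j. Suc n - j"]) auto
  finally show ?thesis by (simp add: fact_prod)
qed

text \<open>
  An injective map between sets of the same size \<open>n!\<close>.
\<close>

lemma bij_betw_lehmer_code: "bij_betw (lehmer_code n) {\<pi>. \<pi> permutes {1..n}} (artin_exponents n)"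
proof -
  have "lehmer_code n ` {\<pi>. \<pi> permutes {1..n}} = artin_exponents n"
  proof (rule card_subset_eq[OF finite_artin_exponents])
    show "lehmer_code n ` {\<pi>. \<pi> permutes {1..n}} \<subseteq> artin_exponents n" using lehmer_code_in by blast
    show "card (lehmer_code n ` {\<pi>. \<pi> permutes {1..n}}) = card (artin_exponents n)"
      unfolding card_image[OF lehmer_code_inj] card_artin_exponents by (rule card_permutations) auto
  qed
  then show ?thesis using lehmer_code_inj by (simp add: bij_betw_def)
qed

lemma card_Collect_bij_betw:
  assumes "bij_betw f A B" "\<And>x. x \<in> A \<Longrightarrow> P x \<longleftrightarrow> Q (f x)"
  shows "card {x \<in> A. P x} = card {y \<in> B. Q y}"
proof -
  have "f ` {x \<in> A. P x} = {y \<in> B. Q y}"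
    using bij_betw_imp_surj_on[OF assms(1)] assms(2) by blast
  moreover have "inj_on f {x \<in> A. P x}"
    using bij_betw_imp_inj_on[OF assms(1)] by (rule inj_on_subset) blast
  ultimately show ?thesis using card_image by metis
qed

definition code_count :: "nat \<Rightarrow> nat \<Rightarrow> nat"
  where "code_count n i = card {a \<in> artin_exponents n. (\<Sum>j\<in>{1..n}. a j) = i}"

lemma inversion_number_eq_code_count: "inversion_number n i = code_count n i"
  using card_Collect_bij_betw[OF bij_betw_lehmer_code[of n], where P = "\<lambda>\<pi>. card (inversions n \<pi>) = i" 
    and Q = "\<lambda>a. (\<Sum>j\<in>{1..n}. a j) = i"]
  by (simp only: inversion_number_def code_count_def sum_lehmer_code mem_Collect_eq)

lemma finite_artin: "finite {m. artin n m}"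
  using bij_betw_finite[OF bij_betw_monomial_of[of n]] finite_artin_exponents by simp

lemma card_artin_monomials: "card {m. artin n m \<and> mon_degree m = i} = inversion_number n i"
proof -
  have "mon_degree (monomial_of n a) = (\<Sum>j\<in>{1..n}. a j)" for a
    by (simp add: mon_degree_eq_weight mon_weight_superset[OF finite_atLeastAtMost keys_monomial_of]
        lookup_monomial_of)
  then have "code_count n i = card {m \<in> {m. artin n m}. mon_degree m = i}"
    unfolding code_count_def by (intro card_Collect_bij_betw[OF bij_betw_monomial_of]) simp
  then show ?thesis by (simp add: inversion_number_eq_code_count)
qed

section \<open>The inversion polynomial\<close>

text \<open>
  Removing the first entry gives a code for \<open>n\<close> with sum at most \<open>i\<close>. Conversely the removed entry is
  what is missing to the sum \<open>i\<close>, and the bound \<open>n\<close> on it is automatic as \<open>i \<le> n\<close>.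
\<close>

lemma code_count_Suc:
  assumes "i \<le> n"
  shows "code_count (Suc n) i = (\<Sum>s\<le>i. code_count n s)"
proof -
  let ?A = "{b \<in> artin_exponents n. (\<Sum>j\<in>{1..n}. b j) \<le> i}"
  let ?B = "{a \<in> artin_exponents (Suc n). (\<Sum>j\<in>{1..Suc n}. a j) = i}"
  define f where "f b = (\<lambda>j\<in>{1..Suc n}. if j = 1 then i - (\<Sum>j\<in>{1..n}. b j) else b (j - 1))" for b :: "nat \<Rightarrow> nat"
  define g where "g a = (\<lambda>j\<in>{1..n}. a (Suc j))" for a :: "nat \<Rightarrow> nat"
  have shift: "(\<Sum>j\<in>{1..Suc n}. a j) = a 1 + (\<Sum>j\<in>{1..n}. a (Suc j))" for a :: "nat \<Rightarrow> nat"
  proof -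
    have "(\<Sum>j\<in>{1..Suc n}. a j) = a 1 + (\<Sum>j\<in>{Suc 1..Suc n}. a j)"
      by (rule sum.atLeast_Suc_atMost) simp
    then show ?thesis by (simp only: sum.shift_bounds_cl_Suc_ivl)
  qed
  have "bij_betw f ?A ?B"
  proof (rule bij_betw_byWitness[where f' = g])
    show "\<forall>b\<in>?A. g (f b) = b"
      by (auto simp: f_def g_def artin_exponents_def fun_eq_iff PiE_def extensional_def restrict_def)
    show "\<forall>a\<in>?B. f (g a) = a"
    proof
      fix a assume a: "a \<in> ?B"
      then have head: "i - (\<Sum>j\<in>{1..n}. g a j) = a 1" using shift[of a] by (simp add: g_def)
      show "f (g a) = a"
      proof
        fix j show "f (g a) j = a j"
          using a unfolding f_def head
          by (auto simp: g_def artin_exponents_def PiE_def extensional_def restrict_def)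
      qed
    qed
    show "f ` ?A \<subseteq> ?B"
    proof (rule image_subsetI)
      fix b assume b: "b \<in> ?A"
      have "f b \<in> artin_exponents (Suc n)"
        unfolding artin_exponents_def
      proof (rule PiE_I)
        fix j assume j: "j \<in> {1..Suc n}"
        show "f b j \<in> {..Suc n - j}"
        proof (cases "j = 1")
          case False
          then have "j - 1 \<in> {1..n}" using j by auto
          then have "b (j - 1) \<le> n - (j - 1)" using b by (auto simp: artin_exponents_def PiE_def Pi_def)
          then show ?thesis using False j by (auto simp: f_def)
        qed (use assms in \<open>auto simp: f_def\<close>)
      qed (auto simp: f_def)
      moreover have "(\<Sum>j\<in>{1..Suc n}. f b j) = i"
        using b by (subst shift) (simp add: f_def)
      ultimately show "f b \<in> ?B" by simp
    qed
    show "g ` ?B \<subseteq> ?A"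
    proof (rule image_subsetI)
      fix a assume a: "a \<in> ?B"
      then have "g a \<in> artin_exponents n" by (auto simp: g_def artin_exponents_def PiE_def Pi_def)
      moreover have "(\<Sum>j\<in>{1..n}. g a j) \<le> i" using a shift[of a] by (simp add: g_def)
      ultimately show "g a \<in> ?A" by simp
    qed
  qed
  then have "code_count (Suc n) i = card ?A"
    by (simp add: code_count_def bij_betw_same_card)
  also have "?A = (\<Union>s\<in>{..i}. {a \<in> artin_exponents n. (\<Sum>j\<in>{1..n}. a j) = s})" by auto
  also have "card \<dots> = (\<Sum>s\<le>i. code_count n s)"
    unfolding code_count_def by (rule card_UN_disjoint) (auto intro: finite_subset[OF _ finite_artin_exponents])
  finally show ?thesis .
qed

lemma code_count_recurrence:
  assumes "Suc i \<le> n"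
  shows "code_count (Suc n) (Suc i) = code_count n (Suc i) + code_count (Suc n) i"
  using assms by (simp add: code_count_Suc)

lemma code_count_0: "code_count n 0 = 1"
proof (induction n)
  case 0
  show ?case by (simp add: code_count_def artin_exponents_def)
qed (simp add: code_count_Suc)

text \<open>
  The binomial theorem expresses \<open>(x + 1)^(k + 1) - x^(k + 1)\<close> as \<open>(k + 1) * x^k\<close> plus lower powers.
\<close>

lemma power_antidifference:
  "\<exists>P :: rat poly. \<forall>x. poly P (x + 1) - poly P x = x ^ k"
proof (induction k rule: less_induct)
  case (less k)
  then obtain Q :: "nat \<Rightarrow> rat poly" where Q: "\<And>i x. i < k \<Longrightarrow> poly (Q i) (x + 1) - poly (Q i) x = x ^ i"
    by metis
  let ?P = "Polynomial.smult (1 / of_nat (Suc k)) (Polynomial.monom 1 (Suc k) - (\<Sum>i<k. Polynomial.smult (of_nat (Suc k choose i)) (Q i)))"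
  have "poly ?P (x + 1) - poly ?P x = x ^ k" for x
  proof -
    have "(x + 1) ^ Suc k = (\<Sum>i\<le>Suc k. of_nat (Suc k choose i) * x ^ i)"
      by (subst binomial_ring) simp
    also have "\<dots> = (\<Sum>i<k. of_nat (Suc k choose i) * x ^ i) + of_nat (Suc k) * x ^ k + x ^ Suc k"
      by (simp add: lessThan_Suc_atMost[symmetric] del: power_Suc of_nat_Suc)
    finally have binom: "(x + 1) ^ Suc k - x ^ Suc k = (\<Sum>i<k. of_nat (Suc k choose i) * x ^ i) + of_nat (Suc k) * x ^ k"
      by simp
    have "(\<Sum>i<k. of_nat (Suc k choose i) * x ^ i)
        = (\<Sum>i<k. of_nat (Suc k choose i) * poly (Q i) (x + 1)) - (\<Sum>i<k. of_nat (Suc k choose i) * poly (Q i) x)"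
      by (simp add: sum_subtractf[symmetric] right_diff_distrib[symmetric] Q)
    then have "of_nat (Suc k) * (poly ?P (x + 1) - poly ?P x) = of_nat (Suc k) * x ^ k"
      using binom by (simp add: poly_monom poly_sum right_diff_distrib[symmetric] diff_divide_distrib[symmetric]
          del: power_Suc of_nat_Suc)
    then show ?thesis using of_nat_neq_0[of k] by (simp only: mult_cancel_left) blast
  qed
  then show ?case by blast
qed

lemma polynomial_antidifference:
  fixes q :: "rat poly"
  shows "\<exists>P. \<forall>x. poly P (x + 1) - poly P x = poly q x"
proof -
  obtain Q :: "nat \<Rightarrow> rat poly" where Q: "\<And>i x. poly (Q i) (x + 1) - poly (Q i) x = x ^ i"
    using power_antidifference by metis
  show ?thesis
  proof (intro exI allI)
    fix x
    show "poly (\<Sum>i\<le>Polynomial.degree q. Polynomial.smult (Polynomial.coeff q i) (Q i)) (x + 1) - poly (\<Sum>i\<le>Polynomial.degree q. Polynomial.smult (Polynomial.coeff q i) (Q i)) x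
        = poly q x"
      by (simp add: poly_sum poly_altdef[of q] sum_subtractf[symmetric] right_diff_distrib[symmetric] Q)
  qed
qed

text \<open>
  For fixed \<open>i + 1\<close> the recurrence gives the differences in \<open>n\<close> as a polynomial in \<open>n\<close>; an
  antidifference, adjusted by a constant to be right at \<open>n = i + 1\<close>, is right from there on.
\<close>

lemma code_count_polynomial:
  "\<exists>p :: rat poly. \<forall>n\<ge>i. poly p (of_nat n) = of_nat (code_count n i)"
proof (induction i)
  case 0
  show ?case by (intro exI[of _ 1]) (simp add: code_count_0)
next
  case (Suc i)
  then obtain p :: "rat poly" where p: "\<And>n. n \<ge> i \<Longrightarrow> poly p (of_nat n) = of_nat (code_count n i)" by blast
  obtain P where P: "\<And>x. poly P (x + 1) - poly P x = poly (pcompose p [:1, 1:]) x"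
    using polynomial_antidifference by blast
  let ?c = "of_nat (code_count (Suc i) (Suc i)) - poly P (of_nat (Suc i))"
  have "poly (P + [:?c:]) (of_nat n) = of_nat (code_count n (Suc i))" if "n \<ge> Suc i" for n
    using that
  proof (induction n rule: dec_induct)
    case (step n)
    have "poly P (of_nat (Suc n)) - poly P (of_nat n) = of_nat (code_count (Suc n) i)"
      using P[of "of_nat n"] p[of "Suc n"] step.hyps by (simp add: poly_pcompose add.commute)
    then show ?case using step code_count_recurrence[of i n] by simp
  qed simp
  then show ?case by blast
qed

lemma inversion_poly:
  assumes "n \<ge> i"
  shows "poly (inversion_poly i) (of_nat n) = of_nat (inversion_number n i)"
proof -
  let ?spec = "\<lambda>p :: rat poly. \<forall>n\<ge>i. poly p (of_nat n) = of_nat (inversion_number n i)"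
  have "\<exists>!p. ?spec p"
  proof (rule ex_ex1I)
    show "\<exists>p. ?spec p" using code_count_polynomial by (simp add: inversion_number_eq_code_count)
    fix p q assume pq: "?spec p" "?spec q"
    have "\<not> finite ((of_nat :: nat \<Rightarrow> rat) ` {i..})"
      by (simp add: finite_image_iff infinite_Ici)
    moreover have "of_nat ` {i..} \<subseteq> {x. poly (p - q) x = 0}" using pq by auto
    ultimately have "p - q = 0" using poly_roots_finite finite_subset by blast
    then show "p = q" by simp
  qed
  from theI'[OF this] assms show ?thesis unfolding inversion_poly_def by blast
qed

section \<open>Tanisaki generators of low degree\<close>

text \<open>
  In degree \<open>i\<close> this ideal is the symmetric one, so the Artin monomials are a basis modulo both. As
  there are no generators of degree 0, the ideal is proper.
\<close>

lemma quot_dim_of_symmetric_low_degree: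
  assumes G: "\<And>e. G e \<subseteq> homogeneous_part n e" and low: "\<And>e. e \<le> i \<Longrightarrow> G e = sym_gens n e"
  shows "quot_dim n (genideal (poly_ring n) (\<Union>e. G e)) i = inversion_number n i"
proof -
  interpret cring "poly_ring n" by (rule cring_poly_ring)
  let ?J = "genideal (poly_ring n) (\<Union>e. G e)"
  have span_eq: "graded_span n G i = graded_span n (sym_gens n) i"
    by (rule graded_span_cong) (rule low)
  have "quot_dim n ?J i = card {m. artin n m \<and> mon_degree m = i}"
  proof (rule quot_dim_eq_card_monomials)
    show "ideal ?J (poly_ring n)"
      using G by (intro genideal_ideal) (fastforce simp: poly_ring_simps dest: homogeneous_part_subset_carrier)
    have degree_0: "p = 0" if "p \<in> graded_span n G 0" for p
      using that by induction (use low[of 0] in \<open>auto simp: sym_gens_def\<close>)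
    then show "1 \<notin> ?J"
      using degree_0[of 1] homogeneous_in_genideal_iff[of G n 1 0] G const_homogeneous[of 1 n] by auto
    show "finite {m. artin n m \<and> mon_degree m = i}"
      by (rule finite_subset[OF _ finite_artin]) blast
    show "Poly_Mapping.single m 1 \<in> homogeneous_part n i" if "m \<in> {m. artin n m \<and> mon_degree m = i}" for m
      using that unfolding homogeneous_part_eq by (intro supported_single) (simp add: artin_def)
    show "\<exists>q\<in>supported (\<lambda>m. m \<in> {m. artin n m \<and> mon_degree m = i}). p - q \<in> ?J"
      if p: "p \<in> homogeneous_part n i" for p
    proof -
      obtain q h where q: "q \<in> supported (\<lambda>m. artin n m \<and> mon_degree m = i)"
        and h: "h \<in> graded_span n (sym_gens n) i" and eq: "p = q + h"
        using artin_monomials_span[OF p] .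
      have h': "h \<in> graded_span n G i" using h span_eq by simp
      have "h \<in> ?J"
        using homogeneous_in_genideal_iff[of G n h i] G graded_span_homogeneous[of G n h i] h' by blast
      then show ?thesis using q by (intro bexI[of _ q]) (simp_all add: eq)
    qed
    show "q = 0" if q: "q \<in> supported (\<lambda>m. m \<in> {m. artin n m \<and> mon_degree m = i})" and J: "q \<in> ?J" for q
    proof (rule artin_monomials_independent)
      show q': "q \<in> supported (\<lambda>m. artin n m \<and> mon_degree m = i)" using q by simp
      have "q \<in> homogeneous_part n i"
        using q' unfolding homogeneous_part_eq by (rule supported_mono) (simp add: artin_def)
      then show "q \<in> graded_span n (sym_gens n) i"
        using homogeneous_in_genideal_iff[of G n q i] G J span_eq by blast
    qed
  qed
  then show ?thesis by (simp add: card_artin_monomials)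
qed

lemma quot_dim_coinvariant_ideal: "quot_dim n (coinvariant_ideal n) i = inversion_number n i"
proof -
  have "{esym j {1..n} |j. j \<in> {1..n}} = (\<Union>e. sym_gens n e)" by (auto simp: sym_gens_def)
  then show ?thesis
    unfolding coinvariant_ideal_def
    using quot_dim_of_symmetric_low_degree[OF sym_gens_homogeneous, of i n] by simp
qed

text \<open>
  The generators are sorted by the entry that gives their degree, not by the degree as a polynomial,
  as \<open>esym e S\<close> may be the zero polynomial.
\<close>

definition graded_tanisaki_gens :: "nat list \<Rightarrow> nat \<Rightarrow> cpoly set"
  where "graded_tanisaki_gens l e = {esym e S |S. S \<subseteq> {1..sum_list l} \<and>
    (\<exists>r c. (r, c) \<in> diagram l \<and> bfr_entry l (r, c) = e \<and> bfr_entry l (0, c) = card S)}"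

lemma Union_graded_tanisaki_gens: "(\<Union>e. graded_tanisaki_gens l e) = tanisaki_gens l"
  by (fastforce simp: graded_tanisaki_gens_def tanisaki_gens_def esyms_def)

lemma diagram_eq_Sigma: "diagram l = (SIGMA r:{..<length l}. {..<l ! r})"
  by (auto simp: diagram_def)

lemma finite_diagram: "finite (diagram l)"
  by (simp add: diagram_eq_Sigma)

lemma card_diagram: "card (diagram l) = sum_list l"
  by (simp add: diagram_eq_Sigma sum_list_sum_nth atLeast0LessThan)

lemma bfr_entry_le: "bfr_entry l b \<le> sum_list l"
  unfolding bfr_entry_def card_diagram[symmetric] by (rule card_mono[OF finite_diagram]) auto

lemma first_column_in_diagram: "partition_of n l \<Longrightarrow> r < length l \<Longrightarrow> (r, 0) \<in> diagram l"
  by (auto simp: partition_of_def diagram_def)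

lemma length_le_partition:
  assumes "partition_of n l"
  shows "length l \<le> n"
proof -
  have "card ((\<lambda>r. (r, 0::nat)) ` {..<length l}) \<le> card (diagram l)"
    using first_column_in_diagram[OF assms] by (intro card_mono finite_diagram) auto
  then show ?thesis
    using assms by (simp add: card_image inj_on_def card_diagram partition_of_def)
qed

lemma bfr_entry_corner: "bfr_entry l (0, 0) = sum_list l"
proof -
  have "{b' \<in> diagram l. fills_before b' (0, 0)} = diagram l" by auto
  then show ?thesis by (simp add: bfr_entry_def card_diagram)
qed

lemma bfr_entry_first_column:
  assumes "partition_of n l" "0 < r" "r < length l"
  shows "bfr_entry l (r, 0) = length l - r"
proof -
  have "{b' \<in> diagram l. fills_before b' (r, 0)} = (\<lambda>r'. (r', 0)) ` {r..<length l}"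
    using assms first_column_in_diagram[OF assms(1)] by (auto simp: diagram_def)
  then show ?thesis by (simp add: bfr_entry_def card_image inj_on_def)
qed

text \<open>
  The boxes of the first column below the top row come before every box of another column or of the
  top row.
\<close>

lemma bfr_entry_other:
  assumes l: "partition_of n l" and box: "(r, c) \<in> diagram l" and "r = 0 \<or> 0 < c"
  shows "length l \<le> bfr_entry l (r, c)"
proof -
  let ?C = "(\<lambda>r'. (r', 0)) ` {1..<length l}"
  have "length l > 0" using box by (auto simp: diagram_def)
  then have "length l = card (insert (r, c) ?C)"
    using assms(3) by (subst card_insert_disjoint) (auto simp: card_image inj_on_def)
  also have "\<dots> \<le> bfr_entry l (r, c)"
    unfolding bfr_entry_def
  proof (rule card_mono)
    show "insert (r, c) ?C \<subseteq> {b' \<in> diagram l. fills_before b' (r, c)}"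
      using box assms(3) first_column_in_diagram[OF l] by auto
  qed (simp add: finite_diagram)
  finally show ?thesis .
qed

lemma graded_tanisaki_gens_low_degree:
  assumes l: "partition_of n l" and e: "e < length l"
  shows "graded_tanisaki_gens l e = sym_gens n e"
proof -
  have n: "sum_list l = n" using l by (simp add: partition_of_def)
  show ?thesis
  proof (intro equalityI subsetI)
    fix f assume "f \<in> graded_tanisaki_gens l e"
    then obtain S r c where f: "f = esym e S" and S: "S \<subseteq> {1..n}" and box: "(r, c) \<in> diagram l"
      and entry: "bfr_entry l (r, c) = e" and top: "bfr_entry l (0, c) = card S"
      unfolding graded_tanisaki_gens_def n by blast
    have "\<not> (r = 0 \<or> 0 < c)" using bfr_entry_other[OF l box] entry e by linarith
    then have rc: "r > 0" "c = 0" by simp_all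
    have "r < length l" using box by (auto simp: diagram_def)
    then have "e \<in> {1..n}"
      using bfr_entry_first_column[OF l] bfr_entry_le[of l "(r, c)"] entry rc n by auto
    moreover have "S = {1..n}"
      using S top by (intro card_subset_eq) (simp_all add: rc bfr_entry_corner n)
    ultimately show "f \<in> sym_gens n e" by (simp add: f sym_gens_def)
  next
    fix f assume "f \<in> sym_gens n e"
    then have f: "f = esym e {1..n}" "e \<in> {1..n}" by (auto simp: sym_gens_def split: if_splits)
    let ?r = "length l - e"
    have "(?r, 0) \<in> diagram l" "bfr_entry l (?r, 0) = e"
      using e f(2) by (auto simp: bfr_entry_first_column[OF l] intro!: first_column_in_diagram[OF l])
    moreover have "bfr_entry l (0, 0) = card {1..n}" by (simp add: bfr_entry_corner n)
    ultimately show "f \<in> graded_tanisaki_gens l e"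
      unfolding graded_tanisaki_gens_def n f(1) by blast
  qed
qed

lemma quot_dim_tanisaki_ideal:
  assumes l: "partition_of n l" and i: "i < length l"
  shows "quot_dim n (tanisaki_ideal l) i = inversion_number n i"
proof -
  have n: "sum_list l = n" using l by (simp add: partition_of_def)
  have "graded_tanisaki_gens l e \<subseteq> homogeneous_part n e" for e
    unfolding graded_tanisaki_gens_def n using esym_homogeneous by blast
  moreover have "graded_tanisaki_gens l e = sym_gens n e" if "e \<le> i" for e
    using graded_tanisaki_gens_low_degree[OF l] that i by simp
  ultimately show ?thesis
    unfolding tanisaki_ideal_def n Union_graded_tanisaki_gens[symmetric]
    by (rule quot_dim_of_symmetric_low_degree)
qed

theorem theorem6:
  fixes lam :: "nat \<Rightarrow> nat list" and k N :: nat
  assumes partitions: "\<And>n. n \<ge> 1 \<Longrightarrow> partition_of n (lam n)"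
    and nested: "\<And>n. n \<ge> 1 \<Longrightarrow> diagram (lam n) \<subseteq> diagram (lam (Suc n))"
    and N: "N \<ge> 1"
    and rows: "length (lam N) \<ge> k + 1"
  shows "(\<forall>i\<le>k. \<forall>n\<ge>N.
            quot_dim n (tanisaki_ideal (lam n)) i = quot_dim n (coinvariant_ideal n) i)
       \<and> (\<forall>i\<le>k. \<forall>n\<ge>N.
            of_nat (quot_dim n (tanisaki_ideal (lam n)) i) = poly (inversion_poly i) (of_nat n))"
proof -
  have long: "k < length (lam n)" if "n \<ge> N" for n
  proof -
    have "diagram (lam N) \<subseteq> diagram (lam n)"
      using that
    proof (induction n rule: dec_induct)
      case (step n)
      then show ?case using nested[of n] N by auto
    qed simp
    moreover have "(k, 0) \<in> diagram (lam N)"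
      using first_column_in_diagram[OF partitions[OF N]] rows by simp
    ultimately show ?thesis by (auto simp: diagram_def)
  qed
  have dim: "quot_dim n (tanisaki_ideal (lam n)) i = inversion_number n i" if "i \<le> k" "n \<ge> N" for i n
    using quot_dim_tanisaki_ideal[OF partitions, of n i] long[OF that(2)] that N by simp
  have "i \<le> n" if "i \<le> k" "n \<ge> N" for i n
    using length_le_partition[OF partitions, of n] long[OF that(2)] that N by simp
  then show ?thesis
    using dim by (simp add: quot_dim_coinvariant_ideal inversion_poly)
qed

end
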